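(* Let $G=(V,E,m,\mu)$ be a complete graph and m is nondegenerate. Then the following are equivalent: (a) G satisfies $CD(K,n)$. (b) For any finitely supported function f,$$\Gamma(P_tf)\leqslant e^{-2Kt}P_t\Gamma(f)-\frac{2}{n}\int_0^t e^{-2Ks}P_S(\triangle P_{t-s}f)^2ds,\quad 0<s<t.$$ (c) For any $f\in D(Q)$,$$\Gamma(P_tf)\leqslant e^{-2Kt}P_t\Gamma(f)-\frac{2}{n}\int_0^t e^{-2Ks}P_S(\triangle P_{t-s}f)^2ds,\quad 0<s<t.$$
   Context: $G=(V,E,\mu,m)$ is a locally finite weighted graph (self-loops allowed) with symmetric edge weights $\mu:E\to[0,\infty)$ (extended by $\mu_{xy}=0$ if $x\nsim y$) and a vertex measure $m:V\to[0,\infty)$. The Laplacian is $\triangle f(x)=\frac{1}{m(x)}\sum_{y\in V}\mu_{xy}(f(y)-f(x))$, and $P_t=e^{t\triangle}$ is the associated heat semigroup on $l^p(V,m)$. $Q(f)=\frac12\sum_{x,y\in V}\mu_{xy}(f(y)-f(x))^2$ is the Dirichlet form with domain $D(Q)$, and $C_0(V)$ denotes the finitely supported functions. $\Gamma(f,g)=\frac12(\triangle(fg)-f\triangle g-g\triangle f)$, $\Gamma(f)=\Gamma(f,f)$, and $\Gamma_2(f)=\frac12\triangle\Gamma(f)-\Gamma(f,\triangle f)$. The graph satisfies $CD(K,n)$ ($K\in\mathbb{R}$) if $\Gamma_2(f)\geqslant\frac1n(\triangle f)^2+K\Gamma(f)$ at every vertex for all $f$. The graph is complete if there is a nondecreasing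 sequence $\eta_k\in C_0(V)$ with $\lim_{k\to\infty}\eta_k=1$ and $\Gamma(\eta_k)\leqslant \frac1k$. The measure $m$ is nondegenerate if $\inf_{x\in V}m(x)>0$. *)

theory Defs
  imports "HOL-Analysis.Analysis"
begin

(* The vertex set V is the universe of the type 'v.  The weight is a function on all pairs of
   vertices, i.e. already extended by 0 off the edge set; self-loops are permitted. *)

record 'v graph_data =
  edges :: "('v \<times> 'v) set"
  weight :: "'v \<Rightarrow> 'v \<Rightarrow> real"
  vmeasure :: "'v \<Rightarrow> real"

definition weighted_graph :: "'v graph_data \<Rightarrow> bool" where
  "weighted_graph G \<longleftrightarrow>
     sym (edges G) \<and>
     (\<forall>x. finite {y. (x, y) \<in> edges G}) \<and>
     (\<forall>x y. weight G x y = weight G y x) \<and>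
     (\<forall>x y. 0 \<le> weight G x y) \<and>
     (\<forall>x y. (x, y) \<notin> edges G \<longrightarrow> weight G x y = 0) \<and>
     (\<forall>x. 0 \<le> vmeasure G x)"

definition nondegenerate :: "'v graph_data \<Rightarrow> bool" where
  "nondegenerate G \<longleftrightarrow> 0 < (INF x. vmeasure G x)"

(* The sum over all vertices y reduces to the finitely many neighbours of x. *)

definition laplacian :: "'v graph_data \<Rightarrow> ('v \<Rightarrow> real) \<Rightarrow> 'v \<Rightarrow> real" where
  "laplacian G f x = (\<Sum>y | (x, y) \<in> edges G. weight G x y * (f y - f x)) / vmeasure G x"

definition Gamma_form :: "'v graph_data \<Rightarrow> ('v \<Rightarrow> real) \<Rightarrow> ('v \<Rightarrow> real) \<Rightarrow> 'v \<Rightarrow> real" where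
  "Gamma_form G f g x =
     (laplacian G (\<lambda>y. f y * g y) x - f x * laplacian G g x - g x * laplacian G f x) / 2"

abbreviation Gamma1 :: "'v graph_data \<Rightarrow> ('v \<Rightarrow> real) \<Rightarrow> 'v \<Rightarrow> real" where
  "Gamma1 G f \<equiv> Gamma_form G f f"

definition Gamma2 :: "'v graph_data \<Rightarrow> ('v \<Rightarrow> real) \<Rightarrow> 'v \<Rightarrow> real" where
  "Gamma2 G f x = laplacian G (Gamma1 G f) x / 2 - Gamma_form G f (laplacian G f) x"

definition CD :: "'v graph_data \<Rightarrow> real \<Rightarrow> real \<Rightarrow> bool" where
  "CD G K n \<longleftrightarrow>
     (\<forall>f x. Gamma2 G f x \<ge> 1 / n * (laplacian G f x)\<^sup>2 + K * Gamma1 G f x)"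

definition C0 :: "('v \<Rightarrow> real) set" where
  "C0 = {f. finite {x. f x \<noteq> 0}}"

(* incseq refers to the pointwise order on functions. *)

definition complete_graph :: "'v graph_data \<Rightarrow> bool" where
  "complete_graph G \<longleftrightarrow>
     (\<exists>\<eta> :: nat \<Rightarrow> 'v \<Rightarrow> real.
        (\<forall>k. \<eta> k \<in> C0) \<and> incseq \<eta> \<and> (\<forall>x. (\<lambda>k. \<eta> k x) \<longlonglongrightarrow> 1) \<and>
        (\<forall>k\<ge>1. \<forall>x. Gamma1 G (\<eta> k) x \<le> 1 / real k))"

definition l2 :: "'v graph_data \<Rightarrow> ('v \<Rightarrow> real) set" where
  "l2 G = {f. (\<lambda>x. vmeasure G x * (f x)\<^sup>2) summable_on UNIV}"

definition l2_inner :: "'v graph_data \<Rightarrow> ('v \<Rightarrow> real) \<Rightarrow> ('v \<Rightarrow> real) \<Rightarrow> real" where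
  "l2_inner G f g = (\<Sum>\<^sub>\<infinity>x. vmeasure G x * f x * g x)"

definition l2_norm :: "'v graph_data \<Rightarrow> ('v \<Rightarrow> real) \<Rightarrow> real" where
  "l2_norm G f = sqrt (l2_inner G f f)"

definition finite_energy :: "'v graph_data \<Rightarrow> ('v \<Rightarrow> real) set" where
  "finite_energy G = {f. (\<lambda>(x, y). weight G x y * (f y - f x)\<^sup>2) summable_on UNIV}"

(* The polarised form; Q(f) is dirichlet_form G f f, meaningful for f of finite energy. *)

definition dirichlet_form :: "'v graph_data \<Rightarrow> ('v \<Rightarrow> real) \<Rightarrow> ('v \<Rightarrow> real) \<Rightarrow> real" where
  "dirichlet_form G f g =
     1 / 2 * (\<Sum>\<^sub>\<infinity>(x, y). weight G x y * (f y - f x) * (g y - g x))"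

definition form_norm :: "'v graph_data \<Rightarrow> ('v \<Rightarrow> real) \<Rightarrow> real" where
  "form_norm G f = sqrt ((l2_norm G f)\<^sup>2 + dirichlet_form G f f)"

(* D(Q): the closure of the finitely supported functions in the form norm. *)

definition form_domain :: "'v graph_data \<Rightarrow> ('v \<Rightarrow> real) set" where
  "form_domain G = {f \<in> l2 G \<inter> finite_energy G.
     \<exists>\<phi> :: nat \<Rightarrow> 'v \<Rightarrow> real.
       (\<forall>k. \<phi> k \<in> C0) \<and> (\<lambda>k. form_norm G (\<lambda>x. f x - \<phi> k x)) \<longlonglongrightarrow> 0}"

(* f is in the domain of the self-adjoint operator associated with (Q, D(Q)), and this operator
   (with the sign convention that it is nonpositive) sends f to h.  Testing against indicator
   functions of vertices shows h = laplacian G f whenever vmeasure G is positive. *)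

definition form_operator :: "'v graph_data \<Rightarrow> ('v \<Rightarrow> real) \<Rightarrow> ('v \<Rightarrow> real) \<Rightarrow> bool" where
  "form_operator G f h \<longleftrightarrow>
     f \<in> form_domain G \<and> h \<in> l2 G \<and>
     (\<forall>g\<in>form_domain G. dirichlet_form G f g = - l2_inner G h g)"

(* P is the semigroup exp(t Laplacian): the strongly continuous symmetric contraction semigroup
   on l2(V,m) generated by the operator associated with the Dirichlet form.  This determines
   P t f for all t \<ge> 0 and f in l2(V,m), and nothing is said about other arguments.  If m is
   nondegenerate, then l1(V,m) is contained in l2(V,m), so this also covers the semigroup
   on l1(V,m). *)

definition heat_semigroup ::
    "'v graph_data \<Rightarrow> (real \<Rightarrow> ('v \<Rightarrow> real) \<Rightarrow> 'v \<Rightarrow> real) \<Rightarrow> bool" where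
  "heat_semigroup G P \<longleftrightarrow>
     (\<forall>t\<ge>0. \<forall>f\<in>l2 G. P t f \<in> l2 G) \<and>
     (\<forall>t\<ge>0. \<forall>f\<in>l2 G. \<forall>g\<in>l2 G. \<forall>a b.
        P t (\<lambda>x. a * f x + b * g x) = (\<lambda>x. a * P t f x + b * P t g x)) \<and>
     (\<forall>t\<ge>0. \<forall>f\<in>l2 G. l2_norm G (P t f) \<le> l2_norm G f) \<and>
     (\<forall>t\<ge>0. \<forall>f\<in>l2 G. \<forall>g\<in>l2 G. l2_inner G (P t f) g = l2_inner G f (P t g)) \<and>
     (\<forall>f\<in>l2 G. P 0 f = f) \<and>
     (\<forall>s\<ge>0. \<forall>t\<ge>0. \<forall>f\<in>l2 G. P (s + t) f = P s (P t f)) \<and>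
     (\<forall>f\<in>l2 G. ((\<lambda>t. l2_norm G (\<lambda>x. P t f x - f x)) \<longlongrightarrow> 0) (at_right 0)) \<and>
     (\<forall>f\<in>l2 G. \<forall>h\<in>l2 G.
        ((\<lambda>t. l2_norm G (\<lambda>x. (P t f x - f x) / t - h x)) \<longlongrightarrow> 0) (at_right 0)
        \<longleftrightarrow> form_operator G f h)"

end

theory Submission
  imports Defs
begin

text \<open>
  Fix a finitely supported function $f$, let $u_t = P_t f$, and let $v_t$ be the difference of the
  two sides of the gradient estimate.  As a function of $t$, the integral term solves a heat
  equation with source $(\triangle u_t)^2$, so that
  $\partial_t v = \triangle v - 2 K v - 2(\Gamma_2(u) - K \Gamma(u) - \frac1n (\triangle u)^2)$ with
  $v_0 = 0$.  Under $CD(K,n)$ this makes $v$ a subsolution that is bounded in $l^2$ (nondegeneracy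
  embeds $l^1$ into $l^2$), and testing with $\eta_k^2 v_+$ for the cut-off functions of a complete
  graph gives $v \le 0$.
  Conversely $v \le 0$ forces $\partial_t v \le 0$ at $t = 0$, which is $CD(K,n)$ for finitely
  supported functions and hence for all functions.  The estimate passes from finitely supported
  functions to the form domain by Fatou's lemma in the time variable, using
  $s \|\triangle P_s g\|^2 \le Q(g)$ and the positivity of $P_s$.
\<close>

section \<open>The weighted sequence spaces\<close>

text \<open>Two obstacles shape the proof. First, P is controlled on l2 only, whereas the estimate
  applies it to Gamma(f) and to squares of Laplacians, which are naturally in l1. The lower bound on
  m embeds l1 in l2 and makes evaluation at a vertex continuous; since the Laplacian at a vertex is
  a finite sum, the equations can be treated vertex by vertex with real-valued calculus. Second, the
  Laplacian may be unbounded, so the equation cannot simply be tested with v_+ over all of V. With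
  eta_k^2 v_+ all sums are finite, and summation by parts leaves only an error of size Gamma(eta_k)
  times the l2 mass of v, that is O(1/k). For f in D(Q) the available bound on the integrand is of
  order Q(f)/(t-s), which is not integrable up to s = t and hence gives no dominating function. But
  the integral occurs with a negative sign, so the lower semicontinuity in Fatou's lemma is the
  direction required. The terms with Gamma(f) converge because the l1 norm of Gamma(f) is
  Q(f).\<close>

locale nondegenerate_graph =
  fixes G :: "'v graph_data"
  assumes weighted: "weighted_graph G"
    and nondegenerate: "nondegenerate G"
begin

abbreviation m :: "'v \<Rightarrow> real" where "m \<equiv> vmeasure G"
abbreviation w :: "'v \<Rightarrow> 'v \<Rightarrow> real" where "w \<equiv> weight G"
abbreviation L :: "('v \<Rightarrow> real) \<Rightarrow> 'v \<Rightarrow> real" where "L \<equiv> laplacian G"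
abbreviation nbrs :: "'v \<Rightarrow> 'v set" where "nbrs x \<equiv> {y. (x, y) \<in> edges G}"

definition m0 :: real where "m0 = (INF x. m x)"

lemma finite_nbrs [simp]: "finite (nbrs x)"
  using weighted by (auto simp: weighted_graph_def)

lemma weight_sym: "w x y = w y x"
  using weighted by (auto simp: weighted_graph_def)

lemma weight_nonneg [simp]: "0 \<le> w x y"
  using weighted by (auto simp: weighted_graph_def)

lemma weight_eq_0: "(x, y) \<notin> edges G \<Longrightarrow> w x y = 0"
  using weighted by (auto simp: weighted_graph_def)

lemma edges_sym: "(x, y) \<in> edges G \<longleftrightarrow> (y, x) \<in> edges G"
  using weighted by (auto simp: weighted_graph_def sym_def)

lemma m0_pos: "0 < m0"
  using nondegenerate by (simp add: nondegenerate_def m0_def)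

lemma m0_le: "m0 \<le> m x"
  unfolding m0_def
  by (rule cINF_lower) (use weighted in \<open>auto simp: weighted_graph_def intro!: bdd_belowI[of _ 0]\<close>)

lemma m_pos [simp]: "0 < m x"
  using m0_pos m0_le[of x] by linarith

lemma m_nonneg [simp]: "0 \<le> m x"
  using m_pos[of x] by linarith

lemma m_not_le_0 [simp]: "\<not> m x \<le> 0"
  using m_pos[of x] by linarith

lemma m_neq_0 [simp]: "m x \<noteq> 0"
  using m_pos[of x] by linarith

definition weighted_l1 :: "('v \<Rightarrow> real) set" where
  "weighted_l1 = {f. (\<lambda>x. m x * \<bar>f x\<bar>) summable_on UNIV}"

definition l1_norm :: "('v \<Rightarrow> real) \<Rightarrow> real" where
  "l1_norm f = (\<Sum>\<^sub>\<infinity>x. m x * \<bar>f x\<bar>)"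

lemma C0_summable:
  assumes "f \<in> C0" "\<And>x. f x = 0 \<Longrightarrow> g x = (0::real)"
  shows "g summable_on UNIV"
proof -
  have "g summable_on {x. f x \<noteq> 0}"
    using assms(1) by (auto simp: C0_def)
  then show ?thesis
    by (rule summable_on_cong_neutral[THEN iffD1, rotated -1]) (use assms(2) in auto)
qed

lemma infsum_finite_support:
  assumes "finite S" "\<And>x. x \<notin> S \<Longrightarrow> g x = (0::real)"
  shows "infsum g UNIV = sum g S"
  using infsum_cong_neutral[of UNIV S g g] assms by auto

lemma C0_subset_l2: "C0 \<subseteq> l2 G"
  unfolding l2_def using C0_summable by fastforce

section \<open>Inner product calculus in l2(V,m)\<close>

lemma l2_mult_summable:
  assumes "f \<in> l2 G" "g \<in> l2 G"
  shows "(\<lambda>x. m x * f x * g x) summable_on UNIV"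
proof -
  have "(\<lambda>x. m x * (f x)\<^sup>2 + m x * (g x)\<^sup>2) summable_on UNIV"
    using assms by (auto simp: l2_def intro!: summable_on_add)
  moreover have "norm (m x * f x * g x) \<le> m x * (f x)\<^sup>2 + m x * (g x)\<^sup>2" for x
  proof -
    have "\<bar>f x * g x\<bar> \<le> (f x)\<^sup>2 + (g x)\<^sup>2"
      using sum_squares_bound[of "\<bar>f x\<bar>" "\<bar>g x\<bar>"] abs_ge_zero[of "f x * g x"]
      by (simp only: abs_mult power2_abs)
    then have "m x * \<bar>f x * g x\<bar> \<le> m x * ((f x)\<^sup>2 + (g x)\<^sup>2)"
      by (intro mult_left_mono) auto
    then show ?thesis by (simp add: abs_mult algebra_simps)
  qed
  ultimately have "(\<lambda>x. norm (m x * f x * g x)) summable_on UNIV"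
    by (rule summable_on_comparison_test) auto
  then show ?thesis
    by (rule abs_summable_summable)
qed

lemma l2_lincomb:
  assumes "f \<in> l2 G" "g \<in> l2 G"
  shows "(\<lambda>x. a * f x + b * g x) \<in> l2 G"
proof -
  have "(\<lambda>x. a\<^sup>2 * (m x * (f x)\<^sup>2) + b\<^sup>2 * (m x * (g x)\<^sup>2) + 2 * a * b * (m x * f x * g x)) summable_on UNIV"
    using assms l2_mult_summable[OF assms]
    by (intro summable_on_add summable_on_cmult_right) (auto simp: l2_def)
  then show ?thesis
    by (simp add: l2_def power2_eq_square algebra_simps)
qed

lemma l2_add: "f \<in> l2 G \<Longrightarrow> g \<in> l2 G \<Longrightarrow> (\<lambda>x. f x + g x) \<in> l2 G"
  using l2_lincomb[of f g 1 1] by simp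

lemma l2_diff: "f \<in> l2 G \<Longrightarrow> g \<in> l2 G \<Longrightarrow> (\<lambda>x. f x - g x) \<in> l2 G"
  using l2_lincomb[of f g 1 "-1"] by simp

lemma l2_scale: "f \<in> l2 G \<Longrightarrow> (\<lambda>x. a * f x) \<in> l2 G"
  using l2_lincomb[of f f a 0] by simp

lemma l2_inner_commute: "l2_inner G f g = l2_inner G g f"
  by (simp add: l2_inner_def mult.assoc mult.commute mult.left_commute)

lemma l2_inner_lincomb:
  assumes "f \<in> l2 G" "g \<in> l2 G" "h \<in> l2 G"
  shows "l2_inner G (\<lambda>x. a * f x + b * g x) h = a * l2_inner G f h + b * l2_inner G g h"
proof -
  have "l2_inner G (\<lambda>x. a * f x + b * g x) h
      = (\<Sum>\<^sub>\<infinity>x. a * (m x * f x * h x) + b * (m x * g x * h x))"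
    unfolding l2_inner_def by (simp add: algebra_simps)
  also have "\<dots> = a * l2_inner G f h + b * l2_inner G g h"
    unfolding l2_inner_def using assms
    by (simp add: infsum_add infsum_cmult_right' summable_on_cmult_right l2_mult_summable)
  finally show ?thesis .
qed

lemma l2_inner_lincomb_right:
  assumes "f \<in> l2 G" "g \<in> l2 G" "h \<in> l2 G"
  shows "l2_inner G h (\<lambda>x. a * f x + b * g x) = a * l2_inner G h f + b * l2_inner G h g"
  using l2_inner_lincomb[OF assms] by (simp add: l2_inner_commute)

lemma l2_inner_diff_right:
  "f \<in> l2 G \<Longrightarrow> g \<in> l2 G \<Longrightarrow> h \<in> l2 G \<Longrightarrow>
    l2_inner G h (\<lambda>x. f x - g x) = l2_inner G h f - l2_inner G h g"
  using l2_inner_lincomb_right[of f g h 1 "-1"] by simp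

lemma l2_inner_self_nonneg: "0 \<le> l2_inner G f f"
  unfolding l2_inner_def by (intro infsum_nonneg) (simp add: mult.assoc)

lemma l2_norm_nonneg [simp]: "0 \<le> l2_norm G f"
  by (simp add: l2_norm_def l2_inner_self_nonneg)

lemma l2_norm_power2: "(l2_norm G f)\<^sup>2 = l2_inner G f f"
  by (simp add: l2_norm_def l2_inner_self_nonneg)

lemma l2_norm_power2_infsum: "(l2_norm G f)\<^sup>2 = (\<Sum>\<^sub>\<infinity>x. m x * (f x)\<^sup>2)"
  unfolding l2_norm_power2 l2_inner_def by (simp add: power2_eq_square mult.assoc)

text \<open>Discriminant argument: the quadratic form of all combinations a f + b g is nonnegative,
  and suitable a, b are substituted.\<close>

lemma Cauchy_Schwarz_l2:
  assumes "f \<in> l2 G" "g \<in> l2 G"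
  shows "\<bar>l2_inner G f g\<bar> \<le> l2_norm G f * l2_norm G g"
proof -
  let ?A = "l2_inner G f f" and ?B = "l2_inner G f g" and ?C = "l2_inner G g g"
  have nn: "0 \<le> a\<^sup>2 * ?A + 2 * a * b * ?B + b\<^sup>2 * ?C" for a b
  proof -
    have l: "(\<lambda>x. a * f x + b * g x) \<in> l2 G" by (rule l2_lincomb[OF assms])
    have "0 \<le> l2_inner G (\<lambda>x. a * f x + b * g x) (\<lambda>x. a * f x + b * g x)"
      by (rule l2_inner_self_nonneg)
    also have "\<dots> = a\<^sup>2 * ?A + 2 * a * b * ?B + b\<^sup>2 * ?C"
      by (simp add: l2_inner_lincomb[OF assms l] l2_inner_lincomb_right[OF assms assms(1)]
          l2_inner_lincomb_right[OF assms assms(2)] l2_inner_commute[of g f] power2_eq_square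
          algebra_simps)
    finally show ?thesis .
  qed
  have "?B\<^sup>2 \<le> ?A * ?C"
  proof (cases "?C = 0")
    case True
    have "?B = 0"
    proof (rule ccontr)
      assume "?B \<noteq> 0"
      \<comment> \<open>With \<open>?C = 0\<close> the form is affine in b; this b gives it the
        value \<open>?A - (?A + 1) = -1\<close>.\<close>
      then show False
        using nn[of 1 "- (?A + 1) / (2 * ?B)"] True l2_inner_self_nonneg[of f]
          by (simp add: field_simps)
    qed
    then show ?thesis using True by simp
  next
    case False
    then have "0 < ?C" using l2_inner_self_nonneg[of g] by simp
    \<comment> \<open>For a = \<open>?C\<close> and b = - \<open>?B\<close> the form factors through
      the discriminant.\<close>
    moreover have "0 \<le> ?C * (?A * ?C - ?B\<^sup>2)"
      using nn[of "?C" "- ?B"] by (simp add: power2_eq_square algebra_simps)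
    ultimately show ?thesis by (simp add: zero_le_mult_iff)
  qed
  then have "sqrt (?B\<^sup>2) \<le> sqrt (?A * ?C)" by (rule real_sqrt_le_mono)
  then show ?thesis by (simp add: l2_norm_def real_sqrt_mult)
qed

lemma l2_norm_triangle:
  assumes "f \<in> l2 G" "g \<in> l2 G"
  shows "l2_norm G (\<lambda>x. f x + g x) \<le> l2_norm G f + l2_norm G g"
proof (rule power2_le_imp_le)
  have l: "(\<lambda>x. 1 * f x + 1 * g x) \<in> l2 G" by (rule l2_lincomb[OF assms])
  have "(l2_norm G (\<lambda>x. f x + g x))\<^sup>2 = l2_inner G (\<lambda>x. 1 * f x + 1 * g x) (\<lambda>x. 1 * f x + 1 * g x)"
    by (simp add: l2_norm_power2)
  also have "\<dots> = (l2_norm G f)\<^sup>2 + 2 * l2_inner G f g + (l2_norm G g)\<^sup>2"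
    by (simp add: l2_inner_lincomb[OF assms l, of 1 1, simplified] 
          l2_inner_lincomb_right[OF assms assms(1), of 1 1, simplified]
          l2_inner_lincomb_right[OF assms assms(2), of 1 1, simplified] 
          l2_inner_commute[of g f] l2_norm_power2)
  also have "\<dots> \<le> (l2_norm G f + l2_norm G g)\<^sup>2"
    using Cauchy_Schwarz_l2[OF assms] by (simp add: power2_eq_square algebra_simps)
  finally show "(l2_norm G (\<lambda>x. f x + g x))\<^sup>2 \<le> (l2_norm G f + l2_norm G g)\<^sup>2" .
qed simp

lemma l2_norm_diff_commute: "l2_norm G (\<lambda>x. f x - g x) = l2_norm G (\<lambda>x. g x - f x)"
  by (simp add: l2_norm_def l2_inner_def power2_eq_square[symmetric] mult.assoc power2_commute)

lemma l2_norm_scale: "l2_norm G (\<lambda>x. a * f x) = \<bar>a\<bar> * l2_norm G f"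
proof -
  have "l2_inner G (\<lambda>x. a * f x) (\<lambda>x. a * f x) = a\<^sup>2 * l2_inner G f f"
    unfolding l2_inner_def by (simp add: power2_eq_square algebra_simps flip: infsum_cmult_right')
  then show ?thesis by (simp add: l2_norm_def real_sqrt_mult)
qed

lemma finite_sum_le_l2_norm:
  assumes "f \<in> l2 G" "finite F"
  shows "(\<Sum>x\<in>F. m x * (f x)\<^sup>2) \<le> (l2_norm G f)\<^sup>2"
proof -
  have "(\<Sum>x\<in>F. m x * (f x)\<^sup>2) \<le> (\<Sum>\<^sub>\<infinity>x. m x * (f x)\<^sup>2)"
    using assms by (intro finite_sum_le_infsum) (auto simp: l2_def)
  then show ?thesis
    by (simp add: l2_norm_power2_infsum)
qed

text \<open>Finite partial sums commute with pointwise limits and with time integrals, so this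
  criterion yields membership in l2 in places where convergence in norm is not yet known.\<close>

lemma l2_bounded_finite_sums:
  assumes "\<And>F. finite F \<Longrightarrow> (\<Sum>x\<in>F. m x * (f x)\<^sup>2) \<le> C\<^sup>2" "0 \<le> C"
  shows "f \<in> l2 G" "l2_norm G f \<le> C"
proof -
  have s: "(\<lambda>x. m x * (f x)\<^sup>2) summable_on UNIV"
    by (rule nonneg_bdd_above_summable_on) (use assms(1) in \<open>auto intro!: bdd_aboveI[of _ "C\<^sup>2"]\<close>)
  then show "f \<in> l2 G" by (simp add: l2_def)
  have "(\<Sum>\<^sub>\<infinity>x. m x * (f x)\<^sup>2) \<le> C\<^sup>2"
    by (rule infsum_le_finite_sums[OF s]) (use assms(1) in auto)
  then have "(l2_norm G f)\<^sup>2 \<le> C\<^sup>2"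
    by (simp add: l2_norm_power2_infsum)
  then show "l2_norm G f \<le> C" using assms(2) by (rule power2_le_imp_le)
qed

text \<open>Since m is at least \<open>m0\<close>, a single vertex already contributes
  \<open>m0 * (f x)^2\<close> to the squared norm. This turns l2 convergence into pointwise
  convergence.\<close>

lemma abs_le_l2_norm:
  assumes "f \<in> l2 G"
  shows "\<bar>f x\<bar> \<le> l2_norm G f / sqrt m0"
proof -
  have "m0 * (f x)\<^sup>2 \<le> m x * (f x)\<^sup>2" by (intro mult_right_mono m0_le) auto
  also have "\<dots> \<le> (l2_norm G f)\<^sup>2" using finite_sum_le_l2_norm[OF assms, of "{x}"] by simp
  finally have "sqrt (m0 * (f x)\<^sup>2) \<le> sqrt ((l2_norm G f)\<^sup>2)" by (rule real_sqrt_le_mono)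
  then show ?thesis using m0_pos by (simp add: real_sqrt_mult field_simps)
qed

section \<open>Weighted l1 and its inclusion in l2\<close>

lemma l1_finite_sum_le:
  assumes "f \<in> weighted_l1" "finite F"
  shows "(\<Sum>x\<in>F. m x * \<bar>f x\<bar>) \<le> l1_norm f"
  using assms unfolding l1_norm_def weighted_l1_def by (intro finite_sum_le_infsum) auto

lemma l1_norm_nonneg: "0 \<le> l1_norm f"
  unfolding l1_norm_def by (intro infsum_nonneg) simp

text \<open>One term of the l1 sum bounds \<open>\<bar>f x\<bar>\<close> by
  \<open>l1_norm f / m0\<close>; using this for one of the two factors of the square leaves another
  l1 norm. It puts Gamma(f) and squares of l2 functions into the domain of the semigroup.\<close>

lemma l1_imp_l2:
  assumes "f \<in> weighted_l1"
  shows "f \<in> l2 G" "l2_norm G f \<le> l1_norm f / sqrt m0"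
proof -
  have b: "(\<Sum>x\<in>F. m x * (f x)\<^sup>2) \<le> (l1_norm f / sqrt m0)\<^sup>2" if F: "finite F" for F
  proof -
    have "m0 * \<bar>f x\<bar> \<le> l1_norm f" for x
      using l1_finite_sum_le[OF assms, of "{x}"] mult_right_mono[OF m0_le[of x], of "\<bar>f x\<bar>"] by simp
    then have f: "\<bar>f x\<bar> \<le> l1_norm f / m0" for x
      using m0_pos by (simp add: field_simps)
    have "(\<Sum>x\<in>F. m x * (f x)\<^sup>2) \<le> (\<Sum>x\<in>F. m x * \<bar>f x\<bar> * (l1_norm f / m0))"
    proof (rule sum_mono)
      fix x
      have "m x * \<bar>f x\<bar> * \<bar>f x\<bar> \<le> m x * \<bar>f x\<bar> * (l1_norm f / m0)"
        by (intro mult_left_mono f) auto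
      then show "m x * (f x)\<^sup>2 \<le> m x * \<bar>f x\<bar> * (l1_norm f / m0)"
        by (simp add: power2_eq_square mult.assoc)
    qed
    also have "\<dots> = (\<Sum>x\<in>F. m x * \<bar>f x\<bar>) * (l1_norm f / m0)" by (simp add: sum_distrib_right sum_divide_distrib)
    also have "\<dots> \<le> l1_norm f * (l1_norm f / m0)"
      using m0_pos by (intro mult_right_mono l1_finite_sum_le[OF assms F]) (simp add: l1_norm_nonneg)
    also have "\<dots> = (l1_norm f / sqrt m0)\<^sup>2"
      using m0_pos by (simp add: power2_eq_square)
    finally show ?thesis .
  qed
  have "0 \<le> l1_norm f / sqrt m0" using m0_pos by (simp add: l1_norm_nonneg)
  from l2_bounded_finite_sums[OF b this]
  show "f \<in> l2 G" "l2_norm G f \<le> l1_norm f / sqrt m0" by auto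
qed

text \<open>Shaped for the pointwise bounds \<open>power2_diff_le\<close> and
  \<open>Gamma1_diff_le\<close>, with \<open>F\<close> the difference of two quadratic
  expressions.\<close>

lemma l1_diff_le:
  assumes "R \<in> weighted_l1" "S \<in> weighted_l1" "0 \<le> a" "0 \<le> b"
    and "\<And>x. \<bar>F x\<bar> \<le> a * R x + b * S x"
  shows "F \<in> weighted_l1" "l1_norm F \<le> a * l1_norm R + b * l1_norm S"
proof -
  have *: "m x * \<bar>F x\<bar> \<le> a * (m x * \<bar>R x\<bar>) + b * (m x * \<bar>S x\<bar>)" for x
  proof -
    have "\<bar>F x\<bar> \<le> a * \<bar>R x\<bar> + b * \<bar>S x\<bar>"
      using assms(5)[of x] mult_left_mono[OF abs_ge_self[of "R x"] assms(3)]
        mult_left_mono[OF abs_ge_self[of "S x"] assms(4)] by linarith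
    then have "m x * \<bar>F x\<bar> \<le> m x * (a * \<bar>R x\<bar> + b * \<bar>S x\<bar>)" by (intro mult_left_mono) auto
    then show ?thesis by (simp add: algebra_simps)
  qed
  have s: "(\<lambda>x. a * (m x * \<bar>R x\<bar>) + b * (m x * \<bar>S x\<bar>)) summable_on UNIV"
    using assms(1,2) unfolding weighted_l1_def by (auto intro!: summable_on_add summable_on_cmult_right)
  show F: "F \<in> weighted_l1"
    unfolding weighted_l1_def mem_Collect_eq by (rule summable_on_comparison_test[OF s]) (use * in auto)
  have "l1_norm F \<le> (\<Sum>\<^sub>\<infinity>x. a * (m x * \<bar>R x\<bar>) + b * (m x * \<bar>S x\<bar>))"
    unfolding l1_norm_def by (rule infsum_mono) (use F s * in \<open>auto simp: weighted_l1_def\<close>)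
  also have "\<dots> = a * l1_norm R + b * l1_norm S"
    using assms(1,2) unfolding weighted_l1_def l1_norm_def
    by (simp add: infsum_add infsum_cmult_right' summable_on_cmult_right)
  finally show "l1_norm F \<le> a * l1_norm R + b * l1_norm S" .
qed

lemma power2_in_l1:
  assumes "f \<in> l2 G"
  shows "(\<lambda>x. (f x)\<^sup>2) \<in> weighted_l1" "l1_norm (\<lambda>x. (f x)\<^sup>2) = (l2_norm G f)\<^sup>2"
  using assms by (auto simp: weighted_l1_def l2_def l1_norm_def l2_norm_power2_infsum)

end

section \<open>Summation by parts and the maximum principle\<close>

text \<open>Squaring removes the kink of the positive part at 0, which is why the energy in the
  maximum principle can be differentiated in time.\<close>

lemma DERIV_pos_part_power2:
  "((\<lambda>z. (max 0 z)\<^sup>2) has_real_derivative 2 * max 0 z) (at z)" for z :: real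
proof -
  consider "z > 0" | "z < 0" | "z = 0" by linarith
  then show ?thesis
  proof cases
    case 1
    have "((\<lambda>z. z\<^sup>2) has_real_derivative 2 * max 0 z) (at z)"
      using 1 by (auto intro!: derivative_eq_intros)
    then show ?thesis
      by (rule has_field_derivative_transform_within_open[of _ _ _ "{0<..}"]) (use 1 in auto)
  next
    case 2
    have "((\<lambda>z. 0) has_real_derivative 2 * max 0 z) (at z)"
      using 2 by (auto intro!: derivative_eq_intros)
    then show ?thesis
      by (rule has_field_derivative_transform_within_open[of _ _ _ "{..<0}"]) (use 2 in auto)
  next
    case 3
    have "((\<lambda>h. (max 0 h)\<^sup>2 / h) \<longlongrightarrow> 0) (at (0::real))"
    proof (rule Lim_null_comparison)
      show "\<forall>\<^sub>F h in at (0::real). norm ((max 0 h)\<^sup>2 / h) \<le> \<bar>h\<bar>"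
        by (intro always_eventually) (auto simp: max_def power2_eq_square)
      show "((\<lambda>h. \<bar>h\<bar>) \<longlongrightarrow> 0) (at (0::real))"
        by (rule tendsto_eq_intros | simp)+
    qed
    then show ?thesis using 3 by (simp add: has_field_derivative_iff)
  qed
qed

context nondegenerate_graph begin

section \<open>Finite-sum calculus for the Laplacian and Gamma\<close>

definition nbhd :: "'v set \<Rightarrow> 'v set" where "nbhd S = S \<union> (\<Union>x\<in>S. nbrs x)"

lemma finite_nbhd: "finite S \<Longrightarrow> finite (nbhd S)"
  by (simp add: nbhd_def)

lemma m_laplacian: "m x * L f x = (\<Sum>y\<in>nbrs x. w x y * (f y - f x))"
  by (simp add: laplacian_def)

text \<open>Replaces the range \<open>nbrs x\<close>, which varies with x, by a fixed finite set, so
  that double sums can be symmetrised by swapping x and y.\<close>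

lemma laplacian_eq_sum:
  assumes "finite N" "\<And>y. y \<notin> N \<Longrightarrow> w x y * (f y - f x) = 0"
  shows "m x * L f x = (\<Sum>y\<in>N. w x y * (f y - f x))"
proof -
  have "m x * L f x = (\<Sum>y\<in>nbrs x. w x y * (f y - f x))"
    by (rule m_laplacian)
  also have "\<dots> = (\<Sum>y\<in>nbrs x \<union> N. w x y * (f y - f x))"
    by (rule sum.mono_neutral_left) (use assms weight_eq_0 in auto)
  also have "\<dots> = (\<Sum>y\<in>N. w x y * (f y - f x))"
    by (rule sum.mono_neutral_right) (use assms weight_eq_0 in auto)
  finally show ?thesis .
qed

lemma laplacian_lincomb: "L (\<lambda>x. a * f x + b * g x) x = a * L f x + b * L g x"
  by (simp add: laplacian_def sum_distrib_left algebra_simps sum.distrib sum_subtractf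
      diff_divide_distrib add_divide_distrib)

lemma laplacian_diff: "L (\<lambda>x. f x - g x) x = L f x - L g x"
  using laplacian_lincomb[of 1 f "-1" g x] by simp

lemma laplacian_scale: "L (\<lambda>x. a * f x) x = a * L f x"
  using laplacian_lincomb[of a f 0 f x] by simp

lemma laplacian_cong: "f x = g x \<Longrightarrow> (\<And>y. y \<in> nbrs x \<Longrightarrow> f y = g y) \<Longrightarrow> L f x = L g x"
  by (simp add: laplacian_def)

lemma Gamma_eq_sum:
  "m x * Gamma_form G f g x = (\<Sum>y\<in>nbrs x. w x y * ((f y - f x) * (g y - g x))) / 2"
proof -
  have "m x * Gamma_form G f g x
    = ((\<Sum>y\<in>nbrs x. w x y * (f y * g y - f x * g x)) - f x * (\<Sum>y\<in>nbrs x. w x y * (g y - g x))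
        - g x * (\<Sum>y\<in>nbrs x. w x y * (f y - f x))) / 2"
    by (simp add: Gamma_form_def laplacian_def field_simps)
  also have "\<dots> = (\<Sum>y\<in>nbrs x. w x y * ((f y - f x) * (g y - g x))) / 2"
    by (simp add: sum_distrib_left algebra_simps sum.distrib sum_subtractf)
  finally show ?thesis .
qed

lemma Gamma1_eq_sum: "m x * Gamma1 G f x = (\<Sum>y\<in>nbrs x. w x y * (f y - f x)\<^sup>2) / 2"
  by (simp add: Gamma_eq_sum power2_eq_square)

lemma Gamma1_nonneg: "0 \<le> Gamma1 G f x"
proof -
  have "0 \<le> m x * Gamma1 G f x" unfolding Gamma1_eq_sum by (intro divide_nonneg_nonneg sum_nonneg) auto
  then show ?thesis by (simp add: zero_le_mult_iff)
qed

text \<open>Young's inequality for the cross term in a^2 - b^2 = (a-b)^2 + 2(a-b)b. The weight of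
  b^2 can be made small at the price of a large weight on (a-b)^2, which tends to 0 in the
  applications.\<close>

lemma power2_diff_le:
  fixes a b \<delta> :: real
  assumes "0 < \<delta>"
  shows "\<bar>a\<^sup>2 - b\<^sup>2\<bar> \<le> (1 + 1 / \<delta>) * (a - b)\<^sup>2 + \<delta> * b\<^sup>2"
proof -
  have *: "2 * \<bar>a - b\<bar> * \<bar>b\<bar> \<le> (a - b)\<^sup>2 / \<delta> + \<delta> * b\<^sup>2"
  proof -
    have "0 \<le> (\<bar>a - b\<bar> / sqrt \<delta> - sqrt \<delta> * \<bar>b\<bar>)\<^sup>2" by simp
    also have "\<dots> = (a - b)\<^sup>2 / \<delta> + \<delta> * b\<^sup>2 - 2 * \<bar>a - b\<bar> * \<bar>b\<bar>"
      using assms by (simp add: power2_diff power_divide power_mult_distrib)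
    finally show ?thesis by simp
  qed
  have "\<bar>a\<^sup>2 - b\<^sup>2\<bar> = \<bar>(a - b)\<^sup>2 + 2 * (a - b) * b\<bar>" by (simp add: power2_eq_square algebra_simps)
  also have "\<dots> \<le> (a - b)\<^sup>2 + 2 * \<bar>a - b\<bar> * \<bar>b\<bar>"
    by (rule order_trans[OF abs_triangle_ineq]) (simp only: abs_mult, simp)
  finally show ?thesis using * by (simp add: algebra_simps)
qed

text \<open>\<open>power2_diff_le\<close> on every edge at x, summed with the edge weights.\<close>

lemma Gamma1_diff_le:
  assumes "0 < \<delta>"
  shows "\<bar>Gamma1 G f x - Gamma1 G g x\<bar>
    \<le> (1 + 1 / \<delta>) * Gamma1 G (\<lambda>y. f y - g y) x + \<delta> * Gamma1 G g x"
proof -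
  have "m x * \<bar>Gamma1 G f x - Gamma1 G g x\<bar> = \<bar>m x * Gamma1 G f x - m x * Gamma1 G g x\<bar>"
    by (simp add: abs_mult flip: right_diff_distrib)
  also have "\<dots> = \<bar>\<Sum>y\<in>nbrs x. w x y * ((f y - f x)\<^sup>2 - (g y - g x)\<^sup>2)\<bar> / 2"
    unfolding Gamma1_eq_sum by (simp add: right_diff_distrib sum_subtractf flip: diff_divide_distrib)
  also have "\<dots> \<le> (\<Sum>y\<in>nbrs x. w x y * ((1 + 1 / \<delta>) * ((f y - g y) - (f x - g x))\<^sup>2 + \<delta> * (g y - g x)\<^sup>2)) / 2"
  proof (intro divide_right_mono order_trans[OF sum_abs] sum_mono)
    fix y
    have "\<bar>(f y - f x)\<^sup>2 - (g y - g x)\<^sup>2\<bar>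
        \<le> (1 + 1 / \<delta>) * ((f y - g y) - (f x - g x))\<^sup>2 + \<delta> * (g y - g x)\<^sup>2"
      using power2_diff_le[OF assms, of "f y - f x" "g y - g x"] by (simp add: algebra_simps)
    then show "\<bar>w x y * ((f y - f x)\<^sup>2 - (g y - g x)\<^sup>2)\<bar>
        \<le> w x y * ((1 + 1 / \<delta>) * ((f y - g y) - (f x - g x))\<^sup>2 + \<delta> * (g y - g x)\<^sup>2)"
      by (simp add: abs_mult mult_left_mono)
  qed simp
  also have "\<dots> = (1 + 1 / \<delta>) * (m x * Gamma1 G (\<lambda>y. f y - g y) x) + \<delta> * (m x * Gamma1 G g x)"
    unfolding Gamma1_eq_sum
    by (simp only: sum_distrib_left distrib_left sum.distrib add_divide_distrib sum_divide_distrib)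
       (simp add: ac_simps)
  finally have "m x * \<bar>Gamma1 G f x - Gamma1 G g x\<bar>
    \<le> m x * ((1 + 1 / \<delta>) * Gamma1 G (\<lambda>y. f y - g y) x + \<delta> * Gamma1 G g x)"
    by (simp only: distrib_left mult.left_commute)
  then show ?thesis by simp
qed

text \<open>Symmetry of the weights lets x and y be exchanged; the sum is the average of itself and
  its exchanged form.\<close>

lemma sum_by_parts:
  "(\<Sum>x\<in>N. \<Sum>y\<in>N. w x y * (a x * (b y - b x)))
    = - (\<Sum>x\<in>N. \<Sum>y\<in>N. w x y * ((a y - a x) * (b y - b x))) / 2" (is "?T = _")
proof -
  have "?T = (\<Sum>x\<in>N. \<Sum>y\<in>N. w y x * (a y * (b x - b y)))" by (rule sum.swap)
  also have "\<dots> = (\<Sum>x\<in>N. \<Sum>y\<in>N. w x y * (a y * (b x - b y)))" by (simp add: weight_sym)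
  finally have "?T + ?T = (\<Sum>x\<in>N. \<Sum>y\<in>N. w x y * (a x * (b y - b x)))
      + (\<Sum>x\<in>N. \<Sum>y\<in>N. w x y * (a y * (b x - b y)))" by simp
  also have "\<dots> = (\<Sum>x\<in>N. \<Sum>y\<in>N. - (w x y * ((a y - a x) * (b y - b x))))"
    unfolding sum.distrib[symmetric] by (simp add: algebra_simps)
  finally show ?thesis by (simp add: sum_negf)
qed

text \<open>A Caccioppoli-type inequality: after summation by parts the gradient of
  \<open>\<eta> p\<close> has a favourable sign and is dropped, so that only the gradient of
  \<open>\<eta>\<close>, weighted with the mass of p, remains. Nothing is presupposed about the
  energy of p.\<close>

lemma C0_cutoff_energy:
  assumes "finite S" "\<And>x. x \<notin> S \<Longrightarrow> \<eta> x = 0"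
    and "\<And>x. Gamma1 G \<eta> x \<le> \<epsilon>" "\<And>F. finite F \<Longrightarrow> (\<Sum>x\<in>F. m x * (p x)\<^sup>2) \<le> M" "0 \<le> \<epsilon>"
  shows "(\<Sum>x\<in>S. (\<eta> x)\<^sup>2 * p x * (m x * L p x)) \<le> \<epsilon> * M"
proof -
  define N where "N = nbhd S"
  have N: "finite N" "S \<subseteq> N" "\<And>x. x \<in> S \<Longrightarrow> nbrs x \<subseteq> N"
    using assms(1) by (auto simp: N_def nbhd_def)
  have "(\<Sum>x\<in>S. (\<eta> x)\<^sup>2 * p x * (m x * L p x))
      = (\<Sum>x\<in>S. \<Sum>y\<in>N. w x y * ((\<eta> x)\<^sup>2 * p x * (p y - p x)))"
  proof (rule sum.cong[OF refl])
    fix x assume x: "x \<in> S"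
    have "m x * L p x = (\<Sum>y\<in>N. w x y * (p y - p x))"
    proof (rule laplacian_eq_sum[OF N(1)])
      fix y assume "y \<notin> N"
      then have "(x, y) \<notin> edges G" using N(3)[OF x] by auto
      then show "w x y * (p y - p x) = 0" by (simp add: weight_eq_0)
    qed
    then show "(\<eta> x)\<^sup>2 * p x * (m x * L p x) = (\<Sum>y\<in>N. w x y * ((\<eta> x)\<^sup>2 * p x * (p y - p x)))"
      by (simp add: sum_distrib_left ac_simps)
  qed
  also have "\<dots> = (\<Sum>x\<in>N. \<Sum>y\<in>N. w x y * ((\<eta> x)\<^sup>2 * p x * (p y - p x)))"
    by (rule sum.mono_neutral_left) (use N assms(2) in auto)
  also have "\<dots> = - (\<Sum>x\<in>N. \<Sum>y\<in>N. w x y * (((\<eta> y)\<^sup>2 * p y - (\<eta> x)\<^sup>2 * p x) * (p y - p x))) / 2"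
    by (rule sum_by_parts)
  also have "\<dots> \<le> (\<Sum>x\<in>N. \<Sum>y\<in>N. w x y * ((\<eta> y - \<eta> x)\<^sup>2 * ((p x)\<^sup>2 + (p y)\<^sup>2) / 2)) / 2"
    unfolding sum_negf[symmetric]
  proof (intro divide_right_mono sum_mono)
    fix x y
    \<comment> \<open>The discrete product rule that isolates the square of the increment of
      \<open>\<eta> p\<close>.\<close>
    have "- (((\<eta> y)\<^sup>2 * p y - (\<eta> x)\<^sup>2 * p x) * (p y - p x))
      = (\<eta> y - \<eta> x)\<^sup>2 * (p x * p y) - (\<eta> y * p y - \<eta> x * p x)\<^sup>2"
      by (simp add: power2_eq_square algebra_simps)
    also have "\<dots> \<le> (\<eta> y - \<eta> x)\<^sup>2 * (p x * p y)" by simp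
    also have "\<dots> \<le> (\<eta> y - \<eta> x)\<^sup>2 * (((p x)\<^sup>2 + (p y)\<^sup>2) / 2)"
      using sum_squares_bound[of "p x" "p y"] by (intro mult_left_mono) auto
    finally have "w x y * - (((\<eta> y)\<^sup>2 * p y - (\<eta> x)\<^sup>2 * p x) * (p y - p x))
      \<le> w x y * ((\<eta> y - \<eta> x)\<^sup>2 * (((p x)\<^sup>2 + (p y)\<^sup>2) / 2))"
      by (rule mult_left_mono) simp
    then show "- (w x y * (((\<eta> y)\<^sup>2 * p y - (\<eta> x)\<^sup>2 * p x) * (p y - p x)))
      \<le> w x y * ((\<eta> y - \<eta> x)\<^sup>2 * ((p x)\<^sup>2 + (p y)\<^sup>2) / 2)"
      by simp
  qed simp
  also have "\<dots> = (\<Sum>x\<in>N. (p x)\<^sup>2 * (\<Sum>y\<in>N. w x y * (\<eta> y - \<eta> x)\<^sup>2)) / 2"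
  proof -
    \<comment> \<open>The edge factor is symmetric in x and y, so the halves with \<open>p x\<close>
      and with \<open>p y\<close> have equal sums and one inner sum becomes the energy of
      \<open>\<eta>\<close> at x.\<close>
    let ?h = "\<lambda>x y. w x y * ((\<eta> y - \<eta> x)\<^sup>2 * (p x)\<^sup>2 / 2)"
    have "(\<Sum>x\<in>N. \<Sum>y\<in>N. w x y * ((\<eta> y - \<eta> x)\<^sup>2 * ((p x)\<^sup>2 + (p y)\<^sup>2) / 2))
      = (\<Sum>x\<in>N. \<Sum>y\<in>N. ?h x y) + (\<Sum>x\<in>N. \<Sum>y\<in>N. ?h y x)"
      unfolding sum.distrib[symmetric] 
      by (intro sum.cong refl) (simp add: weight_sym power2_commute[of "\<eta> _" "\<eta> _"] field_simps)
    also have "(\<Sum>x\<in>N. \<Sum>y\<in>N. ?h y x) = (\<Sum>x\<in>N. \<Sum>y\<in>N. ?h x y)" by (rule sum.swap)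
    finally show ?thesis by (simp add: sum_distrib_left ac_simps flip: sum_divide_distrib)
  qed
  also have "\<dots> \<le> (\<Sum>x\<in>N. (p x)\<^sup>2 * (2 * (m x * \<epsilon>))) / 2"
  proof (intro divide_right_mono sum_mono mult_left_mono)
    fix x
    have "(\<Sum>y\<in>N. w x y * (\<eta> y - \<eta> x)\<^sup>2) \<le> (\<Sum>y\<in>N \<union> nbrs x. w x y * (\<eta> y - \<eta> x)\<^sup>2)"
      by (rule sum_mono2) (use N in auto)
    also have "\<dots> = (\<Sum>y\<in>nbrs x. w x y * (\<eta> y - \<eta> x)\<^sup>2)"
      by (rule sum.mono_neutral_right) (use N weight_eq_0 in auto)
    also have "\<dots> = 2 * (m x * Gamma1 G \<eta> x)" by (simp add: Gamma1_eq_sum)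
    also have "\<dots> \<le> 2 * (m x * \<epsilon>)" by (simp add: assms(3))
    finally show "(\<Sum>y\<in>N. w x y * (\<eta> y - \<eta> x)\<^sup>2) \<le> 2 * (m x * \<epsilon>)" .
  qed auto
  also have "\<dots> = \<epsilon> * (\<Sum>x\<in>N. m x * (p x)\<^sup>2)"
    by (simp add: sum_distrib_left sum_divide_distrib ac_simps)
  also have "\<dots> \<le> \<epsilon> * M" by (intro mult_left_mono assms N)
  finally show ?thesis .
qed

text \<open>The localised energy \<open>E\<close> of the positive part starts at 0 and has
  derivative at most 2M/k, hence is at most 2MT/k at time T; then k tends to infinity with the
  vertex fixed.\<close>

lemma maximum_principle_aux:
  assumes complete: "complete_graph G" and T: "0 \<le> T"
    and der: "\<And>t x. t \<in> {0..T} \<Longrightarrow> ((\<lambda>t. v t x) has_real_derivative v' t x) (at t within {0..T})"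
    and sub: "\<And>t x. t \<in> {0..T} \<Longrightarrow> v' t x \<le> L (v t) x"
    and bd: "\<And>t F. t \<in> {0..T} \<Longrightarrow> finite F \<Longrightarrow> (\<Sum>x\<in>F. m x * (v t x)\<^sup>2) \<le> M"
    and init: "\<And>x. v 0 x \<le> 0"
  shows "v T x \<le> 0"
proof (cases "T = 0")
  case False
  then have T: "0 < T" using T by simp
  from complete obtain \<eta> :: "nat \<Rightarrow> 'v \<Rightarrow> real" where
    \<eta>: "\<And>k. \<eta> k \<in> C0" "\<And>x. (\<lambda>k. \<eta> k x) \<longlonglongrightarrow> 1"
       "\<And>k x. k \<ge> 1 \<Longrightarrow> Gamma1 G (\<eta> k) x \<le> 1 / real k"
    unfolding complete_graph_def by blast
  define p where "p t x = max 0 (v t x)" for t x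
  have bdp: "(\<Sum>x\<in>F. m x * (p t x)\<^sup>2) \<le> M" if "t \<in> {0..T}" "finite F" for t F
  proof -
    have "(\<Sum>x\<in>F. m x * (p t x)\<^sup>2) \<le> (\<Sum>x\<in>F. m x * (v t x)\<^sup>2)"
      by (intro sum_mono mult_left_mono) (auto simp: p_def max_def)
    then show ?thesis using bd[OF that] by linarith
  qed
  have key: "(\<eta> k x)\<^sup>2 * (m x * (p T x)\<^sup>2) \<le> 2 * M * T / real k" if k: "k \<ge> 1" for k
  proof -
    \<comment> \<open>Inserting x guarantees that its own term occurs in \<open>E\<close>, even if
      the cut-off vanishes there.\<close>
    define S where "S = insert x {x. \<eta> k x \<noteq> 0}"
    have S: "finite S" "\<And>x. x \<notin> S \<Longrightarrow> \<eta> k x = 0" "x \<in> S"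
      using \<eta>(1)[of k] by (auto simp: S_def C0_def)
    define E where "E t = (\<Sum>x\<in>S. (\<eta> k x)\<^sup>2 * (m x * (p t x)\<^sup>2))" for t
    define E' where "E' t = (\<Sum>x\<in>S. (\<eta> k x)\<^sup>2 * (m x * (2 * p t x * v' t x)))" for t
    have E: "(E has_real_derivative E' t) (at t within {0..T})" if "t \<in> {0..T}" for t
      unfolding E_def[abs_def] E'_def p_def
      by (intro DERIV_sum DERIV_cmult DERIV_chain2[OF DERIV_pos_part_power2] der[OF that])
    have E': "E' t \<le> 2 * M / real k" if t: "t \<in> {0..T}" for t
    proof -
      have "E' t \<le> (\<Sum>x\<in>S. 2 * ((\<eta> k x)\<^sup>2 * p t x * (m x * L (p t) x)))"
        unfolding E'_def
      proof (rule sum_mono)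
        fix x
        have "p t x * (m x * v' t x) \<le> p t x * (m x * L (v t) x)"
          by (intro mult_left_mono sub[OF t]) (auto simp: p_def)
        also have "\<dots> = (\<Sum>y\<in>nbrs x. w x y * (p t x * (v t y - v t x)))"
          by (simp add: m_laplacian sum_distrib_left ac_simps)
        \<comment> \<open>Kato's inequality: where v is nonpositive both sides vanish; elsewhere v
          and its positive part agree at x, and v is at most its positive part at y.\<close>
        also have "\<dots> \<le> (\<Sum>y\<in>nbrs x. w x y * (p t x * (p t y - p t x)))"
        proof (rule sum_mono, rule mult_left_mono)
          fix y
          show "p t x * (v t y - v t x) \<le> p t x * (p t y - p t x)"
            by (cases "v t x \<le> 0") (auto simp: p_def max_def intro!: mult_left_mono)
        qed auto
        also have "\<dots> = p t x * (m x * L (p t) x)"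
          by (simp add: m_laplacian sum_distrib_left ac_simps)
        finally have "(2 * (\<eta> k x)\<^sup>2) * (p t x * (m x * v' t x))
            \<le> (2 * (\<eta> k x)\<^sup>2) * (p t x * (m x * L (p t) x))"
          by (rule mult_left_mono) simp
        then show "(\<eta> k x)\<^sup>2 * (m x * (2 * p t x * v' t x))
            \<le> 2 * ((\<eta> k x)\<^sup>2 * p t x * (m x * L (p t) x))"
          by (simp add: ac_simps)
      qed
      also have "\<dots> = 2 * (\<Sum>x\<in>S. (\<eta> k x)\<^sup>2 * p t x * (m x * L (p t) x))"
        by (simp add: sum_distrib_left)
      also have "(\<Sum>x\<in>S. (\<eta> k x)\<^sup>2 * p t x * (m x * L (p t) x)) \<le> 1 / real k * M"
        by (rule C0_cutoff_energy) (use S \<eta>(3)[OF k] bdp[OF t] in auto)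
      finally show ?thesis by simp
    qed
    \<comment> \<open>The mean value theorem converts the uniform bound on \<open>E'\<close>
      directly into a bound on \<open>E T\<close>, without integrating \<open>E'\<close>.\<close>
    have "\<exists>\<xi>\<in>{0<..<T}. E T - E 0 = E' \<xi> * (T - 0)"
      by (rule mvt_simple[OF T]) (use E in \<open>auto simp: has_field_derivative_def\<close>)
    then obtain \<xi> where "\<xi> \<in> {0<..<T}" "E T - E 0 = E' \<xi> * T" by auto
    moreover have "p 0 x = 0" for x using init[of x] by (simp add: p_def)
    then have "E 0 = 0" by (simp add: E_def)
    ultimately have "E T = E' \<xi> * T" "\<xi> \<in> {0..T}" by auto
    then have "E T \<le> 2 * M / real k * T" using mult_right_mono[OF E'[of \<xi>], of T] T by simp
    moreover have "(\<eta> k x)\<^sup>2 * (m x * (p T x)\<^sup>2) \<le> E T"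
      unfolding E_def by (rule member_le_sum) (use S in auto)
    ultimately show ?thesis by (simp add: ac_simps)
  qed
  have "m x * (p T x)\<^sup>2 \<le> 0"
  proof (rule LIMSEQ_le)
    show "(\<lambda>k. (\<eta> k x)\<^sup>2 * (m x * (p T x)\<^sup>2)) \<longlonglongrightarrow> m x * (p T x)\<^sup>2"
      using tendsto_mult_right[OF tendsto_power[OF \<eta>(2)[of x], of 2], of "m x * (p T x)\<^sup>2"] by simp
    show "(\<lambda>k. 2 * M * T / real k) \<longlonglongrightarrow> 0"
      by (rule lim_const_over_n)
    show "\<exists>N. \<forall>k\<ge>N. (\<eta> k x)\<^sup>2 * (m x * (p T x)\<^sup>2) \<le> 2 * M * T / real k" using key by blast
  qed
  then have "p T x = 0" by (simp add: mult_le_0_iff)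
  then show ?thesis by (simp add: p_def max_def split: if_splits)
qed (use init in simp)

text \<open>The integrating factor exp(-ct) absorbs the zeroth-order term. As c may have either
  sign, the l2 bound is rescaled with the absolute value of c.\<close>

lemma maximum_principle:
  assumes complete: "complete_graph G" and T: "0 \<le> T"
    and der: "\<And>t x. t \<in> {0..T} \<Longrightarrow> ((\<lambda>t. v t x) has_real_derivative v' t x) (at t within {0..T})"
    and sub: "\<And>t x. t \<in> {0..T} \<Longrightarrow> v' t x \<le> L (v t) x + c * v t x"
    and bd: "\<And>t F. t \<in> {0..T} \<Longrightarrow> finite F \<Longrightarrow> (\<Sum>x\<in>F. m x * (v t x)\<^sup>2) \<le> M"
    and init: "\<And>x. v 0 x \<le> 0"
  shows "v T x \<le> 0"
proof -
  define u where "u t x = exp (- c * t) * v t x" for t x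
  define u' where "u' t x = exp (- c * t) * (v' t x - c * v t x)" for t x
  have "u T x \<le> 0"
  proof (rule maximum_principle_aux[OF complete T, where v' = u' and M = "exp (2 * \<bar>c\<bar> * T) * M"])
    fix t x assume t: "t \<in> {0..T}"
    show "((\<lambda>t. u t x) has_real_derivative u' t x) (at t within {0..T})"
      unfolding u_def u'_def by (rule derivative_eq_intros der[OF t] refl | simp add: algebra_simps)+
    have "L (u t) x = exp (- c * t) * L (v t) x"
      unfolding u_def by (rule laplacian_scale)
    moreover have "exp (- c * t) * (v' t x - c * v t x) \<le> exp (- c * t) * L (v t) x"
      using sub[OF t, of x] by (intro mult_left_mono) auto
    ultimately show "u' t x \<le> L (u t) x" by (simp add: u'_def)
  next
    fix t and F :: "'v set" assume t: "t \<in> {0..T}" and F: "finite F"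
    have "(\<Sum>x\<in>F. m x * (u t x)\<^sup>2) = exp (- 2 * c * t) * (\<Sum>x\<in>F. m x * (v t x)\<^sup>2)"
      by (simp add: u_def power_mult_distrib sum_distrib_left ac_simps flip: exp_double)
    also have "\<dots> \<le> exp (2 * \<bar>c\<bar> * T) * M"
    proof (intro mult_mono bd[OF t F])
      have "- c * t \<le> \<bar>c\<bar> * t" using t by (intro mult_right_mono) auto
      also have "\<dots> \<le> \<bar>c\<bar> * T" using t by (intro mult_left_mono) auto
      finally have "- c * t \<le> \<bar>c\<bar> * T" .
      then have "- 2 * c * t \<le> 2 * \<bar>c\<bar> * T" by linarith
      then show "exp (- 2 * c * t) \<le> exp (2 * \<bar>c\<bar> * T)" by simp
    qed (auto intro!: sum_nonneg)
    finally show "(\<Sum>x\<in>F. m x * (u t x)\<^sup>2) \<le> exp (2 * \<bar>c\<bar> * T) * M" .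
  qed (simp add: u_def init)
  then show ?thesis by (simp add: u_def mult_le_0_iff not_le[symmetric])
qed

end

section \<open>The Dirichlet form\<close>

context nondegenerate_graph begin

text \<open>An edge with one end in \<open>S\<close> has both ends in \<open>nbhd S\<close>; on all
  other pairs either the weight or the increment of f is 0.\<close>

lemma weight_diff_outside:
  assumes "\<And>x. x \<notin> S \<Longrightarrow> f x = 0" "(x, y) \<notin> nbhd S \<times> nbhd S"
  shows "w x y * (f y - f x) = 0"
proof (cases "(x, y) \<in> edges G")
  case True
  then have "x \<notin> S" "y \<notin> S"
    using assms(2) edges_sym[of x y] by (auto simp: nbhd_def)
  then show ?thesis using assms(1) by simp
qed (simp add: weight_eq_0)

lemma C0_finite_energy:
  assumes "f \<in> C0"
  shows "f \<in> finite_energy G"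
proof -
  define N where "N = nbhd {x. f x \<noteq> 0}"
  have N: "finite N" using assms by (simp add: N_def C0_def finite_nbhd)
  let ?h = "\<lambda>(x, y). w x y * (f y - f x)\<^sup>2"
  have "?h z = 0" if "z \<notin> N \<times> N" for z
    using weight_diff_outside[of "{x. f x \<noteq> 0}" f "fst z" "snd z"] that
    by (auto simp: N_def split: prod.splits)
  moreover have "?h summable_on N \<times> N" using N by simp
  ultimately have "?h summable_on UNIV"
    by (subst summable_on_cong_neutral[of "N \<times> N" UNIV ?h ?h]) auto
  then show ?thesis by (simp add: finite_energy_def)
qed

lemma laplacian_C0:
  assumes "f \<in> C0"
  shows "L f \<in> C0"
proof -
  have "L f x = 0" if "x \<notin> nbhd {x. f x \<noteq> 0}" for x
  proof -
    have "m x * L f x = (\<Sum>y\<in>{}. w x y * (f y - f x))"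
    proof (rule laplacian_eq_sum)
      fix y
      show "w x y * (f y - f x) = 0"
        by (rule weight_diff_outside[of "{x. f x \<noteq> 0}"]) (use that in auto)
    qed simp
    then show ?thesis by simp
  qed
  then have "{x. L f x \<noteq> 0} \<subseteq> nbhd {x. f x \<noteq> 0}" by auto
  then show ?thesis
    using assms finite_nbhd by (auto simp: C0_def intro: finite_subset)
qed

text \<open>Both identities compare with one finite double sum over \<open>nbhd\<close> of the
  support of f. Because all sums are finite, g may be an arbitrary function, which allows testing
  with vertices later.\<close>

lemma
  assumes "f \<in> C0"
  shows dirichlet_eq_laplacian: "dirichlet_form G f g = - l2_inner G (L f) g"
    and laplacian_symmetric: "l2_inner G (L f) g = l2_inner G f (L g)"
proof -
  define S where "S = {x. f x \<noteq> 0}"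
  define N where "N = nbhd S"
  have f0: "f x = 0" if "x \<notin> S" for x using that by (simp add: S_def)
  have S: "finite S" using assms by (simp add: S_def C0_def)
  have N: "finite N" "S \<subseteq> N" "\<And>x. x \<in> S \<Longrightarrow> nbrs x \<subseteq> N"
    using S by (auto simp: N_def nbhd_def)
  have out: "w x y * (f y - f x) = 0" if "(x, y) \<notin> N \<times> N" for x y
    using weight_diff_outside[of S f x y] f0 that by (simp add: N_def)
  have "(\<Sum>\<^sub>\<infinity>(x, y). w x y * (f y - f x) * (g y - g x))
      = (\<Sum>(x, y)\<in>N \<times> N. w x y * (f y - f x) * (g y - g x))"
  proof (rule infsum_finite_support)
    fix z assume "z \<notin> N \<times> N"
    then show "(case z of (x, y) \<Rightarrow> w x y * (f y - f x) * (g y - g x)) = 0"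
      using out[of "fst z" "snd z"] by (auto split: prod.splits)
  qed (use N in simp)
  then have D: "dirichlet_form G f g
      = (\<Sum>x\<in>N. \<Sum>y\<in>N. w x y * ((f y - f x) * (g y - g x))) / 2"
    by (simp add: dirichlet_form_def sum.cartesian_product mult.assoc)
  have Lf: "m x * L f x = (\<Sum>y\<in>N. w x y * (f y - f x))" if "x \<in> N" for x
    by (rule laplacian_eq_sum) (use N out that in auto)
  have Lf0: "L f x = 0" if "x \<notin> N" for x
  proof -
    have "m x * L f x = (\<Sum>y\<in>{}. w x y * (f y - f x))"
      by (rule laplacian_eq_sum) (use out that in auto)
    then show ?thesis by simp
  qed
  have "l2_inner G (L f) g = (\<Sum>x\<in>N. m x * L f x * g x)"
    unfolding l2_inner_def by (rule infsum_finite_support) (use N Lf0 in auto)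
  also have "\<dots> = (\<Sum>x\<in>N. \<Sum>y\<in>N. w x y * (g x * (f y - f x)))"
    by (rule sum.cong[OF refl]) (simp add: Lf sum_distrib_left ac_simps)
  also have "\<dots> = - (\<Sum>x\<in>N. \<Sum>y\<in>N. w x y * ((g y - g x) * (f y - f x))) / 2"
    by (rule sum_by_parts)
  finally have 1: "l2_inner G (L f) g = - dirichlet_form G f g"
    by (simp add: D ac_simps)
  then show "dirichlet_form G f g = - l2_inner G (L f) g" by simp
  have "l2_inner G f (L g) = (\<Sum>x\<in>N. m x * f x * L g x)"
    unfolding l2_inner_def by (rule infsum_finite_support) (use N f0 in auto)
  also have "\<dots> = (\<Sum>x\<in>N. \<Sum>y\<in>N. w x y * (f x * (g y - g x)))"
  proof (rule sum.cong[OF refl])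
    fix x assume "x \<in> N"
    \<comment> \<open>A point of \<open>N\<close> outside the support of f may have neighbours
      outside \<open>N\<close>, where g is not 0; there the factor \<open>f x\<close> makes both
      sides vanish.\<close>
    show "m x * f x * L g x = (\<Sum>y\<in>N. w x y * (f x * (g y - g x)))"
    proof (cases "x \<in> S")
      case True
      have "m x * L g x = (\<Sum>y\<in>N. w x y * (g y - g x))"
      proof (rule laplacian_eq_sum[OF N(1)])
        fix y assume "y \<notin> N"
        then have "(x, y) \<notin> edges G" using N(3)[OF True] by auto
        then show "w x y * (g y - g x) = 0" by (simp add: weight_eq_0)
      qed
      then have "f x * (m x * L g x) = f x * (\<Sum>y\<in>N. w x y * (g y - g x))" by simp
      then show ?thesis by (simp add: sum_distrib_left ac_simps)
    qed (simp add: f0)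
  qed
  also have "\<dots> = - (\<Sum>x\<in>N. \<Sum>y\<in>N. w x y * ((f y - f x) * (g y - g x))) / 2"
    by (rule sum_by_parts)
  finally show "l2_inner G (L f) g = l2_inner G f (L g)"
    by (simp add: 1 D ac_simps)
qed

lemma dirichlet_form_commute: "dirichlet_form G f g = dirichlet_form G g f"
  by (simp add: dirichlet_form_def mult.assoc mult.commute[of "f _ - f _"])

lemma dirichlet_form_nonneg: "0 \<le> dirichlet_form G f f"
  unfolding dirichlet_form_def
  by (intro mult_nonneg_nonneg infsum_nonneg) (auto simp: mult.assoc)

lemma dirichlet_form_self:
  "dirichlet_form G f f = (\<Sum>\<^sub>\<infinity>(x, y). w x y * (f y - f x)\<^sup>2) / 2"
  by (simp add: dirichlet_form_def power2_eq_square mult.assoc)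

lemma C0_form_domain: "f \<in> C0 \<Longrightarrow> f \<in> form_domain G"
  using C0_subset_l2
  by (auto simp: form_domain_def C0_finite_energy form_norm_def l2_norm_def l2_inner_def
      dirichlet_form_def case_prod_unfold intro!: exI[of _ "\<lambda>_. f"])

definition delta :: "'v \<Rightarrow> 'v \<Rightarrow> real" where "delta a x = (if x = a then 1 else 0)"

lemma delta_C0: "delta a \<in> C0"
  by (simp add: C0_def delta_def)

lemma l2_inner_delta: "l2_inner G f (delta a) = m a * f a"
proof -
  have "l2_inner G f (delta a) = (\<Sum>x\<in>{a}. m x * f x * delta a x)"
    unfolding l2_inner_def by (rule infsum_finite_support) (auto simp: delta_def)
  then show ?thesis by (simp add: delta_def)
qed

lemma form_operator_C0:
  assumes "f \<in> C0"
  shows "form_operator G f (L f)"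
  using assms laplacian_C0[OF assms] C0_subset_l2
  by (auto simp: form_operator_def C0_form_domain dirichlet_eq_laplacian)

text \<open>Testing with \<open>delta x\<close> and moving the Laplacian off it by
  \<open>laplacian_symmetric\<close> identifies the abstract generator with the pointwise
  formula.\<close>

lemma form_operator_eq_laplacian:
  assumes "form_operator G u h"
  shows "h x = L u x"
proof -
  have "m x * h x = l2_inner G h (delta x)" by (simp add: l2_inner_delta)
  also have "\<dots> = - dirichlet_form G u (delta x)"
    using assms by (simp add: form_operator_def C0_form_domain delta_C0)
  also have "\<dots> = l2_inner G (L (delta x)) u"
    by (simp add: dirichlet_form_commute[of u] dirichlet_eq_laplacian[OF delta_C0])
  also have "\<dots> = m x * L u x"
    by (simp add: laplacian_symmetric[OF delta_C0] l2_inner_commute[of "delta x"] l2_inner_delta)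
  finally show ?thesis by simp
qed

text \<open>Fubini over ordered pairs of vertices. This is the bridge from convergence of energies
  to l1 convergence of Gamma.\<close>

lemma Gamma1_l1:
  assumes "f \<in> finite_energy G"
  shows "Gamma1 G f \<in> weighted_l1" "l1_norm (Gamma1 G f) = dirichlet_form G f f"
proof -
  have s: "(\<lambda>(x, y). w x y * (f y - f x)\<^sup>2) summable_on UNIV \<times> UNIV"
    using assms by (simp add: finite_energy_def)
  have inner: "(\<Sum>\<^sub>\<infinity>y. w x y * (f y - f x)\<^sup>2) = 2 * (m x * \<bar>Gamma1 G f x\<bar>)" for x
  proof -
    have "(\<Sum>\<^sub>\<infinity>y. w x y * (f y - f x)\<^sup>2) = (\<Sum>y\<in>nbrs x. w x y * (f y - f x)\<^sup>2)"
      by (rule infsum_finite_support) (auto simp: weight_eq_0)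
    then show ?thesis by (simp add: Gamma1_eq_sum Gamma1_nonneg)
  qed
  from summable_on_Sigma_banach[OF s]
  have "(\<lambda>x. 1 / 2 * (2 * (m x * \<bar>Gamma1 G f x\<bar>))) summable_on UNIV"
    unfolding inner by (rule summable_on_cmult_right)
  then show "Gamma1 G f \<in> weighted_l1" by (simp add: weighted_l1_def)
  have "2 * l1_norm (Gamma1 G f) = (\<Sum>\<^sub>\<infinity>x. 2 * (m x * \<bar>Gamma1 G f x\<bar>))"
    unfolding l1_norm_def by (rule infsum_cmult_right'[symmetric])
  also have "\<dots> = (\<Sum>\<^sub>\<infinity>(x, y)\<in>UNIV\<times>UNIV. w x y * (f y - f x)\<^sup>2)"
    unfolding inner[symmetric] by (rule infsum_Sigma'_banach[OF s])
  finally show "l1_norm (Gamma1 G f) = dirichlet_form G f f"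
    by (simp add: dirichlet_form_self)
qed

text \<open>From (a-b)^2 \<le> 2a^2 + 2b^2 on every edge. The factor 2 lost here is recovered from
  the 2 in \<open>laplacian_P_bound\<close>.\<close>

lemma dirichlet_form_diff_le:
  assumes "f \<in> finite_energy G" "g \<in> finite_energy G"
  shows "(\<lambda>x. f x - g x) \<in> finite_energy G"
    "dirichlet_form G (\<lambda>x. f x - g x) (\<lambda>x. f x - g x)
      \<le> 2 * dirichlet_form G f f + 2 * dirichlet_form G g g"
proof -
  let ?F = "\<lambda>f (x, y). w x y * (f y - f x)\<^sup>2"
  have le: "?F (\<lambda>x. f x - g x) z \<le> 2 * ?F f z + 2 * ?F g z" for z
  proof -
    obtain x y where z: "z = (x, y)" by force
    have "((f y - g y) - (f x - g x))\<^sup>2 \<le> 2 * (f y - f x)\<^sup>2 + 2 * (g y - g x)\<^sup>2"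
      using sum_squares_ge_zero[of "(f y - f x) + (g y - g x)" 0]
      by (simp add: power2_eq_square algebra_simps)
    then have "w x y * ((f y - g y) - (f x - g x))\<^sup>2 \<le> w x y * (2 * (f y - f x)\<^sup>2 + 2 * (g y - g x)\<^sup>2)"
      by (rule mult_left_mono) simp
    then show ?thesis by (simp add: z algebra_simps)
  qed
  have sF: "?F f summable_on UNIV" "?F g summable_on UNIV"
    using assms by (auto simp: finite_energy_def)
  then have s: "(\<lambda>z. 2 * ?F f z + 2 * ?F g z) summable_on UNIV"
    by (intro summable_on_add summable_on_cmult_right)
  have s': "?F (\<lambda>x. f x - g x) summable_on UNIV"
    by (rule summable_on_comparison_test[OF s]) (use le in auto)
  then show "(\<lambda>x. f x - g x) \<in> finite_energy G" by (simp add: finite_energy_def)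
  have "infsum (?F (\<lambda>x. f x - g x)) UNIV \<le> (\<Sum>\<^sub>\<infinity>z. 2 * ?F f z + 2 * ?F g z)"
    by (rule infsum_mono[OF s' s]) (rule le)
  also have "\<dots> = 2 * infsum (?F f) UNIV + 2 * infsum (?F g) UNIV"
    using sF by (subst infsum_add) (auto simp: infsum_cmult_right' intro!: summable_on_cmult_right)
  finally show "dirichlet_form G (\<lambda>x. f x - g x) (\<lambda>x. f x - g x)
      \<le> 2 * dirichlet_form G f f + 2 * dirichlet_form G g g"
    by (simp add: dirichlet_form_self)
qed

lemma form_domain_approx:
  assumes "f \<in> form_domain G"
  obtains \<phi> where "\<And>k::nat. \<phi> k \<in> C0"
    "(\<lambda>k. l2_norm G (\<lambda>x. f x - \<phi> k x)) \<longlonglongrightarrow> 0"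
    "(\<lambda>k. dirichlet_form G (\<lambda>x. f x - \<phi> k x) (\<lambda>x. f x - \<phi> k x)) \<longlonglongrightarrow> 0"
proof -
  from assms obtain \<phi> where \<phi>: "\<And>k::nat. \<phi> k \<in> C0"
    "(\<lambda>k. form_norm G (\<lambda>x. f x - \<phi> k x)) \<longlonglongrightarrow> 0"
    by (auto simp: form_domain_def)
  let ?a = "\<lambda>k. l2_norm G (\<lambda>x. f x - \<phi> k x)"
    and ?b = "\<lambda>k. dirichlet_form G (\<lambda>x. f x - \<phi> k x) (\<lambda>x. f x - \<phi> k x)"
  have nn: "0 \<le> ?b k" for k by (rule dirichlet_form_nonneg)
  have a: "?a \<longlonglongrightarrow> 0"
  proof (rule tendsto_sandwich[OF _ _ tendsto_const \<phi>(2)])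
    show "\<forall>\<^sub>F k in sequentially. ?a k \<le> form_norm G (\<lambda>x. f x - \<phi> k x)"
      unfolding form_norm_def by (intro always_eventually allI real_le_rsqrt) (simp add: nn)
  qed (auto intro!: always_eventually)
  have b: "?b \<longlonglongrightarrow> 0"
  proof (rule tendsto_sandwich[OF _ _ tendsto_const])
    show "(\<lambda>k. (form_norm G (\<lambda>x. f x - \<phi> k x))\<^sup>2) \<longlonglongrightarrow> 0"
      using tendsto_power[OF \<phi>(2), of 2] by simp
    show "\<forall>\<^sub>F k in sequentially. ?b k \<le> (form_norm G (\<lambda>x. f x - \<phi> k x))\<^sup>2"
      unfolding form_norm_def by (intro always_eventually allI) (simp add: nn add_nonneg_nonneg)
  qed (auto intro!: always_eventually nn)
  show ?thesis using that[OF \<phi>(1) a b] .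
qed

text \<open>Shift the approximating sequence by g. It makes bounds for the form domain applicable to
  the error of an approximation.\<close>

lemma form_domain_diff_C0:
  assumes "f \<in> form_domain G" "g \<in> C0"
  shows "(\<lambda>x. f x - g x) \<in> form_domain G"
proof -
  from assms obtain \<phi> where \<phi>: "\<And>k::nat. \<phi> k \<in> C0"
    "(\<lambda>k. form_norm G (\<lambda>x. f x - \<phi> k x)) \<longlonglongrightarrow> 0"
    by (auto simp: form_domain_def)
  have "(\<lambda>x. \<phi> k x - g x) \<in> C0" for k
    using \<phi>(1)[of k] assms(2) unfolding C0_def mem_Collect_eq
    by (rule finite_subset[OF _ finite_UnI, rotated 1]) auto
  moreover have "(\<lambda>k. form_norm G (\<lambda>x. (f x - g x) - (\<phi> k x - g x))) \<longlonglongrightarrow> 0"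
    using \<phi>(2) by simp
  moreover have "(\<lambda>x. f x - g x) \<in> l2 G \<inter> finite_energy G"
    using assms C0_subset_l2 C0_finite_energy l2_diff dirichlet_form_diff_le(1)
    by (auto simp: form_domain_def)
  ultimately show ?thesis unfolding form_domain_def mem_Collect_eq by (intro conjI exI allI)
qed

end

section \<open>Regularity of the heat semigroup\<close>

text \<open>First delta is fixed small against c, then r is taken small against 1 + 1/delta; this is
  how the two weights of \<open>power2_diff_le\<close> are played off.\<close>

lemma tendsto_0_interpolate:
  fixes a r :: "'i \<Rightarrow> real"
  assumes "\<forall>\<^sub>F i in F. 0 \<le> a i" "0 \<le> c"
    and "\<And>\<delta>. 0 < \<delta> \<Longrightarrow> \<forall>\<^sub>F i in F. a i \<le> (1 + 1 / \<delta>) * r i + \<delta> * c"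
    and r: "(r \<longlongrightarrow> 0) F"
  shows "(a \<longlongrightarrow> 0) F"
proof (rule tendstoI)
  fix e :: real assume e: "0 < e"
  \<comment> \<open>The summand 1 keeps the denominator positive when c = 0.\<close>
  define \<delta> where "\<delta> = e / (2 * (c + 1))"
  have \<delta>: "0 < \<delta>" "\<delta> * c \<le> e / 2" using e assms(2) by (auto simp: \<delta>_def field_simps)
  have "((\<lambda>i. (1 + 1 / \<delta>) * r i) \<longlongrightarrow> 0) F" using tendsto_mult_right_zero[OF r] .
  then have "\<forall>\<^sub>F i in F. (1 + 1 / \<delta>) * r i < e / 2"
    by (rule order_tendstoD) (use e in simp)
  with assms(1) assms(3)[OF \<delta>(1)] show "\<forall>\<^sub>F i in F. dist (a i) 0 < e"
    unfolding dist_real_def by eventually_elim (use \<delta>(2) in linarith)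
qed

context nondegenerate_graph begin

text \<open>Squaring is continuous from l2 to l1.\<close>

lemma l1_norm_power2_tendsto:
  assumes "\<forall>\<^sub>F i in F. \<alpha> i \<in> l2 G" "\<beta> \<in> l2 G"
    and lim: "((\<lambda>i. l2_norm G (\<lambda>x. \<alpha> i x - \<beta> x)) \<longlongrightarrow> 0) F"
  shows "((\<lambda>i. l1_norm (\<lambda>x. (\<alpha> i x)\<^sup>2 - (\<beta> x)\<^sup>2)) \<longlongrightarrow> 0) F"
proof (rule tendsto_0_interpolate[where c = "(l2_norm G \<beta>)\<^sup>2"])
  show "((\<lambda>i. (l2_norm G (\<lambda>x. \<alpha> i x - \<beta> x))\<^sup>2) \<longlongrightarrow> 0) F"
    using tendsto_power[OF lim, of 2] by simp
  fix \<delta> :: real assume \<delta>: "0 < \<delta>"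
  show "\<forall>\<^sub>F i in F. l1_norm (\<lambda>x. (\<alpha> i x)\<^sup>2 - (\<beta> x)\<^sup>2)
      \<le> (1 + 1 / \<delta>) * (l2_norm G (\<lambda>x. \<alpha> i x - \<beta> x))\<^sup>2 + \<delta> * (l2_norm G \<beta>)\<^sup>2"
    using assms(1)
  proof eventually_elim
    case (elim i)
    note d = l2_diff[OF elim assms(2)]
    show ?case
      using l1_diff_le(2)[OF power2_in_l1(1)[OF d] power2_in_l1(1)[OF assms(2)] _ _ power2_diff_le[OF \<delta>]] \<delta>
      by (simp add: power2_in_l1(2)[OF d] power2_in_l1(2)[OF assms(2)])
  qed
qed (auto intro!: always_eventually l1_norm_nonneg)

end

locale heat_graph = nondegenerate_graph G for G :: "'v graph_data" +
  fixes P :: "real \<Rightarrow> ('v \<Rightarrow> real) \<Rightarrow> 'v \<Rightarrow> real"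
  assumes heat: "heat_semigroup G P"
    and complete: "complete_graph G"
begin

section \<open>First consequences of the semigroup axioms\<close>

lemma P_l2: "0 \<le> t \<Longrightarrow> f \<in> l2 G \<Longrightarrow> P t f \<in> l2 G"
  using heat by (simp add: heat_semigroup_def)

lemma P_lincomb: "0 \<le> t \<Longrightarrow> f \<in> l2 G \<Longrightarrow> g \<in> l2 G \<Longrightarrow>
    P t (\<lambda>x. a * f x + b * g x) = (\<lambda>x. a * P t f x + b * P t g x)"
  using heat by (simp add: heat_semigroup_def)

lemma P_contraction: "0 \<le> t \<Longrightarrow> f \<in> l2 G \<Longrightarrow> l2_norm G (P t f) \<le> l2_norm G f"
  using heat by (simp add: heat_semigroup_def)

lemma P_symmetric:
  "0 \<le> t \<Longrightarrow> f \<in> l2 G \<Longrightarrow> g \<in> l2 G \<Longrightarrow> l2_inner G (P t f) g = l2_inner G f (P t g)"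
  using heat by (simp add: heat_semigroup_def)

lemma P_0: "f \<in> l2 G \<Longrightarrow> P 0 f = f"
  using heat by (simp add: heat_semigroup_def)

lemma P_add: "0 \<le> s \<Longrightarrow> 0 \<le> t \<Longrightarrow> f \<in> l2 G \<Longrightarrow> P (s + t) f = P s (P t f)"
  using heat by (simp add: heat_semigroup_def)

lemma P_continuous_0:
  "f \<in> l2 G \<Longrightarrow> ((\<lambda>t. l2_norm G (\<lambda>x. P t f x - f x)) \<longlongrightarrow> 0) (at_right 0)"
  using heat by (simp add: heat_semigroup_def)

lemma P_generator:
  "f \<in> l2 G \<Longrightarrow> h \<in> l2 G \<Longrightarrow>
    ((\<lambda>t. l2_norm G (\<lambda>x. (P t f x - f x) / t - h x)) \<longlongrightarrow> 0) (at_right 0) \<longleftrightarrow> form_operator G f h"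
  using heat by (simp add: heat_semigroup_def)

lemma P_diff: "0 \<le> t \<Longrightarrow> f \<in> l2 G \<Longrightarrow> g \<in> l2 G \<Longrightarrow>
    P t (\<lambda>x. f x - g x) = (\<lambda>x. P t f x - P t g x)"
  using P_lincomb[of t f g 1 "-1"] by simp

lemma abs_P_le_l2:
  assumes "0 \<le> t" "f \<in> l2 G"
  shows "\<bar>P t f x\<bar> \<le> l2_norm G f / sqrt m0"
proof -
  have "\<bar>P t f x\<bar> \<le> l2_norm G (P t f) / sqrt m0"
    using assms by (intro abs_le_l2_norm P_l2)
  also have "\<dots> \<le> l2_norm G f / sqrt m0"
    using assms m0_pos by (intro divide_right_mono P_contraction) auto
  finally show ?thesis .
qed

text \<open>P reaches l1 functions only through the inclusion in l2. The inclusion and the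
  evaluation at x each cost a factor 1/sqrt(m0).\<close>

lemma abs_P_le_l1:
  assumes "0 \<le> t" "f \<in> weighted_l1"
  shows "\<bar>P t f x\<bar> \<le> l1_norm f / m0"
proof -
  have "\<bar>P t f x\<bar> \<le> l2_norm G f / sqrt m0"
    using assms by (intro abs_P_le_l2 l1_imp_l2)
  also have "\<dots> \<le> l1_norm f / sqrt m0 / sqrt m0"
    using assms m0_pos by (intro divide_right_mono l1_imp_l2) auto
  finally show ?thesis using m0_pos by simp
qed

lemma P_tendsto_l1:
  assumes "0 \<le> t" "\<forall>\<^sub>F i in F. g i \<in> l2 G \<and> (\<lambda>x. g i x - h x) \<in> weighted_l1" "h \<in> l2 G"
    and lim: "((\<lambda>i. l1_norm (\<lambda>x. g i x - h x)) \<longlongrightarrow> 0) F"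
  shows "((\<lambda>i. P t (g i) x) \<longlongrightarrow> P t h x) F"
proof -
  have "((\<lambda>i. P t (g i) x - P t h x) \<longlongrightarrow> 0) F"
  proof (rule Lim_null_comparison)
    show "((\<lambda>i. l1_norm (\<lambda>x. g i x - h x) / m0) \<longlongrightarrow> 0) F"
      using tendsto_divide[OF lim tendsto_const, of m0] m0_pos by simp
    show "\<forall>\<^sub>F i in F. norm (P t (g i) x - P t h x) \<le> l1_norm (\<lambda>x. g i x - h x) / m0"
      using assms(2)
    proof eventually_elim
      case (elim i)
      then show ?case
        using abs_P_le_l1[OF assms(1), of "\<lambda>x. g i x - h x" x] P_diff[OF assms(1), of "g i" h] assms(3)
        by simp
    qed
  qed
  then show ?thesis by (simp add: LIM_zero_iff)
qed

text \<open>The semigroup law factors out P at the smaller time and contraction removes it. Thus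
  strong continuity at 0 from the right gives two-sided continuity at every time.\<close>

lemma P_diff_le:
  assumes "0 \<le> s" "0 \<le> t" "f \<in> l2 G"
  shows "l2_norm G (\<lambda>x. P s f x - P t f x) \<le> l2_norm G (\<lambda>x. P \<bar>s - t\<bar> f x - f x)"
proof -
  have *: "l2_norm G (\<lambda>x. P s f x - P t f x) \<le> l2_norm G (\<lambda>x. P (s - t) f x - f x)"
    if "0 \<le> t" "t \<le> s" for s t
  proof -
    have "P s f = P t (P (s - t) f)" using P_add[of t "s - t" f] that assms(3) by simp
    then have "(\<lambda>x. P s f x - P t f x) = P t (\<lambda>x. P (s - t) f x - f x)"
      using P_diff[of t "P (s - t) f" f] P_l2[of "s - t" f] that assms(3) by simp
    then show ?thesis
      using P_contraction[of t "\<lambda>x. P (s - t) f x - f x"] l2_diff P_l2[of "s - t" f] that assms(3)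
      by simp
  qed
  show ?thesis
  proof (cases "t \<le> s")
    case True
    then show ?thesis using *[of t s] assms by simp
  next
    case False
    then show ?thesis using *[of s t] assms by (simp add: l2_norm_diff_commute[of "P s f"])
  qed
qed

lemma filterlim_abs_diff_at_right:
  "filterlim (\<lambda>s. \<bar>s - t\<bar>) (at_right 0) (at t within (S :: real set))"
  unfolding filterlim_at
proof (intro conjI)
  show "\<forall>\<^sub>F s in at t within S. \<bar>s - t\<bar> \<in> {0<..} \<and> \<bar>s - t\<bar> \<noteq> 0"
    by (auto simp: eventually_at_filter)
  show "((\<lambda>s. \<bar>s - t\<bar>) \<longlongrightarrow> 0) (at t within S)"
    by (rule tendsto_eq_intros refl | simp)+
qed

lemma P_continuous:
  assumes "0 \<le> t" "f \<in> l2 G"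
  shows "((\<lambda>s. l2_norm G (\<lambda>x. P s f x - P t f x)) \<longlongrightarrow> 0) (at t within {0..})"
proof (rule tendsto_sandwich[OF _ _ tendsto_const])
  show "((\<lambda>s. l2_norm G (\<lambda>x. P \<bar>s - t\<bar> f x - f x)) \<longlongrightarrow> 0) (at t within {0..})"
    by (rule filterlim_compose[OF P_continuous_0[OF assms(2)] filterlim_abs_diff_at_right])
  show "\<forall>\<^sub>F s in at t within {0..}. l2_norm G (\<lambda>x. P s f x - P t f x)
      \<le> l2_norm G (\<lambda>x. P \<bar>s - t\<bar> f x - f x)"
    unfolding eventually_at_filter using P_diff_le assms by (auto intro!: always_eventually)
qed (auto intro!: always_eventually)

text \<open>The generator is known explicitly on \<open>C0\<close>, so the time derivative is put on
  g while f stays a general l2 function. Contraction reduces the quotient at time t to the one-sided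
  quotient at 0, for increments of either sign.\<close>

lemma P_weak_derivative:
  assumes f: "f \<in> l2 G" and g: "g \<in> C0" and t: "0 \<le> t"
  shows "((\<lambda>t. l2_inner G f (P t g)) has_real_derivative l2_inner G f (P t (L g))) (at t within {0..})"
  unfolding has_field_derivative_iff
proof (rule LIM_zero_cancel, rule Lim_null_comparison)
  have gl: "g \<in> l2 G" "L g \<in> l2 G" using g laplacian_C0 C0_subset_l2 by auto
  define Dq where "Dq d = (\<lambda>x. (P d g x - g x) / d - L g x)" for d
  define R where "R d = l2_norm G f * (l2_norm G (Dq d) + l2_norm G (\<lambda>x. P d (L g) x - L g x))" for d
  have "(R \<longlongrightarrow> l2_norm G f * (0 + 0)) (at_right 0)"
    unfolding R_def Dq_def
    by (intro tendsto_mult tendsto_const tendsto_add P_continuous_0 gl P_generator[THEN iffD2] form_operator_C0 g)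
  then have "(R \<longlongrightarrow> 0) (at_right 0)" by simp
  then show "((\<lambda>s. R \<bar>s - t\<bar>) \<longlongrightarrow> 0) (at t within {0..})"
    by (rule filterlim_compose[OF _ filterlim_abs_diff_at_right])
  show "\<forall>\<^sub>F s in at t within {0..}. norm ((l2_inner G f (P s g) - l2_inner G f (P t g)) / (s - t)
      - l2_inner G f (P t (L g))) \<le> R \<bar>s - t\<bar>"
    unfolding eventually_at_filter
  proof (intro always_eventually allI impI)
    fix s assume s: "s \<noteq> t" "s \<in> {0..}"
    \<comment> \<open>Symmetric in s and t: the quotient between s and t equals P at the earlier
      time a applied to the quotient at 0 with step d.\<close>
    define a d where "a = min s t" and "d = \<bar>s - t\<bar>"
    have ad: "0 \<le> a" "0 < d" using s t by (auto simp: a_def d_def)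
    have Dl: "Dq d \<in> l2 G"
    proof -
      have "(\<lambda>x. 1 / d * (P d g x - g x) + (-1) * L g x) \<in> l2 G"
        using ad gl by (intro l2_lincomb l2_diff P_l2) auto
      then show ?thesis by (simp add: Dq_def)
    qed
    have quot: "(P s g x - P t g x) / (s - t) = (P a (P d g) x - P a g x) / d" for x
    proof (cases "t < s")
      case True
      then have "P s g = P a (P d g)" using P_add[of a d g] ad gl by (simp add: a_def d_def)
      then show ?thesis using True by (simp add: a_def d_def)
    next
      case False
      then have "P t g = P a (P d g)" using P_add[of a d g] ad gl s by (simp add: a_def d_def)
      moreover have "(P s g x - P t g x) / (s - t) = (P t g x - P s g x) / (t - s)"
        by (metis minus_diff_eq minus_divide_divide)
      ultimately show ?thesis using False s by (simp add: a_def d_def)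
    qed
    have PD: "P a (Dq d) x = (P s g x - P t g x) / (s - t) - P a (L g) x" for x
    proof -
      have "Dq d = (\<lambda>x. 1 / d * (P d g x - g x) + (-1) * L g x)" by (simp add: Dq_def)
      then have "P a (Dq d) = (\<lambda>x. 1 / d * P a (\<lambda>x. P d g x - g x) x + (-1) * P a (L g) x)"
        using P_lincomb[of a "\<lambda>x. P d g x - g x" "L g" "1/d" "-1"] ad gl P_l2[of d g] l2_diff by simp
      moreover have "P a (\<lambda>x. P d g x - g x) = (\<lambda>x. P a (P d g) x - P a g x)"
        using ad gl by (intro P_diff P_l2) auto
      ultimately show ?thesis by (simp add: quot)
    qed
    have eq: "(\<lambda>x. 1 / (s - t) * (P s g x - P t g x) - P t (L g) x)
        = (\<lambda>x. P a (Dq d) x + (P a (L g) x - P t (L g) x))" (is "?l = ?r")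
      by (simp add: PD)
    have Pl: "P s g \<in> l2 G" "P t g \<in> l2 G" "P t (L g) \<in> l2 G" "P a (L g) \<in> l2 G" "P a (Dq d) \<in> l2 G"
      using s t ad gl Dl by (auto intro: P_l2)
    have lhs: "(l2_inner G f (P s g) - l2_inner G f (P t g)) / (s - t) - l2_inner G f (P t (L g))
        = l2_inner G f ?l"
      using l2_inner_lincomb_right[OF l2_diff[OF Pl(1,2)] Pl(3) f, of "1 / (s - t)" "-1"]
        l2_inner_diff_right[OF Pl(1,2) f] by simp
    have "norm (l2_inner G f ?l) \<le> l2_norm G f * l2_norm G ?r"
      unfolding eq using Cauchy_Schwarz_l2[OF f l2_add[OF Pl(5) l2_diff[OF Pl(4,3)]]] by simp
    also have "\<dots> \<le> R d"
      unfolding R_def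
    proof (rule mult_left_mono)
      have "l2_norm G ?r \<le> l2_norm G (P a (Dq d)) + l2_norm G (\<lambda>x. P a (L g) x - P t (L g) x)"
        by (rule l2_norm_triangle[OF Pl(5) l2_diff[OF Pl(4,3)]])
      also have "\<dots> \<le> l2_norm G (Dq d) + l2_norm G (\<lambda>x. P \<bar>a - t\<bar> (L g) x - L g x)"
        using ad t gl Dl by (intro add_mono P_contraction P_diff_le) auto
      \<comment> \<open>For s > t one has a = t and the left side is 0; otherwise a = s and the two
        sides coincide.\<close>
      also have "l2_norm G (\<lambda>x. P \<bar>a - t\<bar> (L g) x - L g x) \<le> l2_norm G (\<lambda>x. P d (L g) x - L g x)"
      proof (cases "t < s")
        case True
        moreover have "l2_norm G (\<lambda>x. 0) = 0" by (simp add: l2_norm_def l2_inner_def)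
        ultimately show ?thesis using P_0[OF gl(2)] by (simp add: a_def)
      qed (simp add: a_def d_def)
      finally show "l2_norm G ?r \<le> l2_norm G (Dq d) + l2_norm G (\<lambda>x. P d (L g) x - L g x)"
        by simp
    qed simp
    finally show "norm ((l2_inner G f (P s g) - l2_inner G f (P t g)) / (s - t)
      - l2_inner G f (P t (L g))) \<le> R \<bar>s - t\<bar>" unfolding lhs d_def .
  qed
qed

text \<open>The heat equation at a vertex for every l2 initial value, even outside the domain of the
  generator: evaluation at x is pairing with \<open>delta x\<close>, symmetry moves P onto that
  function, and the derivative falls there.\<close>

lemma P_derivative:
  assumes "f \<in> l2 G" "0 \<le> t"
  shows "((\<lambda>t. P t f x) has_real_derivative L (P t f) x) (at t within {0..})"
proof -
  have d: "delta x \<in> l2 G" "L (delta x) \<in> l2 G"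
    using delta_C0[of x] laplacian_C0[OF delta_C0] C0_subset_l2 by auto
  have 1: "P s f x = l2_inner G f (P s (delta x)) / m x" if "0 \<le> s" for s
    using P_symmetric[OF that assms(1) d(1)] by (simp add: l2_inner_delta eq_divide_eq mult.commute)
  have "l2_inner G f (P t (L (delta x))) = l2_inner G (L (delta x)) (P t f)"
    using P_symmetric[OF assms(2,1) d(2)] by (simp add: l2_inner_commute)
  also have "\<dots> = m x * L (P t f) x"
    by (simp add: laplacian_symmetric[OF delta_C0] l2_inner_commute[of "delta x"] l2_inner_delta)
  finally have 2: "L (P t f) x = l2_inner G f (P t (L (delta x))) / m x" by simp
  have "((\<lambda>s. l2_inner G f (P s (delta x)) / m x) has_real_derivative L (P t f) x) (at t within {0..})"
    unfolding 2 by (rule DERIV_cdivide[OF P_weak_derivative[OF assms(1) delta_C0 assms(2)]])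
  then show ?thesis
    by (rule has_field_derivative_transform_within[OF _ zero_less_one]) (use assms 1 in auto)
qed

text \<open>P at time t commutes with difference quotients and contracts, so the orbit stays in the
  domain of the generator. Commutation with the Laplacian, finite energy and the energy identity on
  \<open>C0\<close> follow.\<close>

lemma P_form_operator:
  assumes f: "f \<in> C0" and t: "0 \<le> t"
  shows "form_operator G (P t f) (P t (L f))"
proof -
  have l: "f \<in> l2 G" "L f \<in> l2 G" using f laplacian_C0 C0_subset_l2 by auto
  have "((\<lambda>h. l2_norm G (\<lambda>x. (P h (P t f) x - P t f x) / h - P t (L f) x)) \<longlongrightarrow> 0) (at_right 0)"
  proof (rule tendsto_sandwich[OF _ _ tendsto_const])
    show "((\<lambda>h. l2_norm G (\<lambda>x. (P h f x - f x) / h - L f x)) \<longlongrightarrow> 0) (at_right 0)"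
      using P_generator[OF l] form_operator_C0[OF f] by simp
    show "\<forall>\<^sub>F h in at_right 0. l2_norm G (\<lambda>x. (P h (P t f) x - P t f x) / h - P t (L f) x)
        \<le> l2_norm G (\<lambda>x. (P h f x - f x) / h - L f x)"
      unfolding eventually_at_filter
    proof (intro always_eventually allI impI)
      fix h :: real assume "h \<in> {0<..}"
      then have h: "0 < h" by simp
      have "P h (P t f) = P t (P h f)"
        using P_add[of h t f] P_add[of t h f] h t l by (simp add: add.commute)
      moreover have "P t (\<lambda>x. 1 / h * (P h f x - f x) + (-1) * L f x)
          = (\<lambda>x. 1 / h * (P t (P h f) x - P t f x) + (-1) * P t (L f) x)"
        using P_lincomb[of t "\<lambda>x. P h f x - f x" "L f" "1 / h" "-1"] P_diff[of t "P h f" f]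
          h t l P_l2[of h f] l2_diff by simp
      ultimately have eq: "(\<lambda>x. (P h (P t f) x - P t f x) / h - P t (L f) x)
          = P t (\<lambda>x. 1 / h * (P h f x - f x) + (-1) * L f x)" by simp
      have "l2_norm G (P t (\<lambda>x. 1 / h * (P h f x - f x) + (-1) * L f x)) \<le> l2_norm G (\<lambda>x. 1 / h * (P h f x - f x) + (-1) * L f x)"
        using h t l by (intro P_contraction l2_lincomb l2_diff P_l2) auto
      then show "l2_norm G (\<lambda>x. (P h (P t f) x - P t f x) / h - P t (L f) x)
        \<le> l2_norm G (\<lambda>x. (P h f x - f x) / h - L f x)" unfolding eq by simp
    qed
  qed (auto intro!: always_eventually)
  then show ?thesis using P_generator[of "P t f" "P t (L f)"] P_l2 t l by simp
qed

lemma P_laplacian_commute: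
  assumes "f \<in> C0" "0 \<le> t"
  shows "L (P t f) = P t (L f)"
  using form_operator_eq_laplacian[OF P_form_operator[OF assms]] by auto

lemma P_finite_energy:
  assumes "f \<in> C0" "0 \<le> t"
  shows "P t f \<in> finite_energy G"
  using P_form_operator[OF assms] by (auto simp: form_operator_def form_domain_def)

lemma dirichlet_P:
  assumes "f \<in> C0" "0 \<le> t"
  shows "dirichlet_form G (P t f) (P t f) = - l2_inner G (P t (L f)) (P t f)"
  using P_form_operator[OF assms] by (auto simp: form_operator_def)

lemma dirichlet_P_le:
  assumes "f \<in> C0" "0 \<le> t"
  shows "dirichlet_form G (P t f) (P t f) \<le> l2_norm G (L f) * l2_norm G f"
proof -
  have l: "f \<in> l2 G" "L f \<in> l2 G" using assms(1) laplacian_C0 C0_subset_l2 by auto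
  have "dirichlet_form G (P t f) (P t f) \<le> \<bar>l2_inner G (P t (L f)) (P t f)\<bar>"
    unfolding dirichlet_P[OF assms] by simp
  also have "\<dots> \<le> l2_norm G (P t (L f)) * l2_norm G (P t f)"
    using l assms(2) by (intro Cauchy_Schwarz_l2 P_l2)
  also have "\<dots> \<le> l2_norm G (L f) * l2_norm G f"
    using l assms(2) by (intro mult_mono P_contraction) auto
  finally show ?thesis .
qed

text \<open>A substitute for the spectral theorem. The derivative of \<psi>(r) = <Lf, P_r f> is the
  squared norm of P_{r/2} Lf and is nonincreasing in r, so its value at r = 2s is at most the mean
  slope over [0, 2s]. The total increase is at most Q(f), as \<psi>(0) = -Q(f) and \<psi>(2s) =
  -Q(P_s f).\<close>

lemma laplacian_P_bound:
  assumes f: "f \<in> C0" and s: "0 < s"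
  shows "2 * s * (l2_norm G (L (P s f)))\<^sup>2 \<le> dirichlet_form G f f"
proof -
  have l: "f \<in> l2 G" "L f \<in> l2 G" using f laplacian_C0 C0_subset_l2 by auto
  have half: "l2_inner G (L f) (P (2 * \<tau>) h) = l2_inner G (P \<tau> (L f)) (P \<tau> h)"
    if "0 \<le> \<tau>" "h \<in> l2 G" for \<tau> h
  proof -
    have "P (2 * \<tau>) h = P \<tau> (P \<tau> h)" unfolding mult_2 by (rule P_add[OF that(1) that])
    then show ?thesis using P_symmetric[of \<tau> "L f" "P \<tau> h"] P_l2[of \<tau> h] l that by simp
  qed
  define \<psi> where "\<psi> \<tau> = l2_inner G (L f) (P \<tau> f)" for \<tau>
  have "\<exists>\<xi>\<in>{0<..<2 * s}. \<psi> (2 * s) - \<psi> 0 = l2_inner G (L f) (P \<xi> (L f)) * (2 * s - 0)"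
    unfolding \<psi>_def
  proof (rule mvt_simple)
    fix \<tau> assume "0 \<le> \<tau>" "\<tau> \<le> 2 * s"
    then have "((\<lambda>\<tau>. l2_inner G (L f) (P \<tau> f)) has_real_derivative l2_inner G (L f) (P \<tau> (L f))) (at \<tau> within {0..2 * s})"
      by (intro DERIV_subset[OF P_weak_derivative] l f) auto
    then show "((\<lambda>\<tau>. l2_inner G (L f) (P \<tau> f)) has_derivative (*) (l2_inner G (L f) (P \<tau> (L f)))) (at \<tau> within {0..2 * s})"
      by (simp add: has_field_derivative_def)
  qed (use s in simp)
  then obtain \<xi> where \<xi>: "0 < \<xi>" "\<xi> < 2 * s" "\<psi> (2 * s) - \<psi> 0 = l2_inner G (L f) (P \<xi> (L f)) * (2 * s)"
    by auto
  have "\<psi> 0 = - dirichlet_form G f f"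
    by (simp add: \<psi>_def P_0[OF l(1)] dirichlet_eq_laplacian[OF f])
  moreover have "\<psi> (2 * s) \<le> 0"
    using half[of s f] dirichlet_P[OF f, of s] dirichlet_form_nonneg[of "P s f"] s l by (simp add: \<psi>_def)
  ultimately have le: "l2_inner G (L f) (P \<xi> (L f)) * (2 * s) \<le> dirichlet_form G f f" using \<xi>(3) by linarith
  \<comment> \<open>Since \<xi>/2 < s, contraction compares the slope at the intermediate point with
    the one at 2s.\<close>
  have "P s (L f) = P (s - \<xi> / 2) (P (\<xi> / 2) (L f))"
    using P_add[of "s - \<xi> / 2" "\<xi> / 2" "L f"] \<xi> l by simp
  then have "l2_norm G (P s (L f)) \<le> l2_norm G (P (\<xi> / 2) (L f))"
    using P_contraction[of "s - \<xi> / 2" "P (\<xi> / 2) (L f)"] P_l2[of "\<xi> / 2"] \<xi> l by simp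
  then have "(l2_norm G (P s (L f)))\<^sup>2 \<le> (l2_norm G (P (\<xi> / 2) (L f)))\<^sup>2"
    by (intro power_mono) auto
  also have "\<dots> = l2_inner G (L f) (P \<xi> (L f))"
    using half[of "\<xi> / 2" "L f"] \<xi> l by (simp add: l2_norm_power2)
  finally have "(l2_norm G (P s (L f)))\<^sup>2 * (2 * s) \<le> l2_inner G (L f) (P \<xi> (L f)) * (2 * s)"
    using s by (intro mult_right_mono) auto
  from order_trans[OF this le] show ?thesis
    by (simp add: P_laplacian_commute[OF f less_imp_le[OF s]] ac_simps)
qed

text \<open>Positivity is not among the axioms of \<open>heat_semigroup\<close>; completeness
  supplies it through the maximum principle for -P_t f.\<close>

lemma P_nonneg:
  assumes f: "f \<in> l2 G" "\<And>x. 0 \<le> f x" and t: "0 \<le> t"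
  shows "0 \<le> P t f x"
proof -
  have "- P t f x \<le> 0"
  proof (rule maximum_principle_aux[OF complete t, where v = "\<lambda>t x. - P t f x"
        and v' = "\<lambda>t x. - L (P t f) x" and M = "(l2_norm G f)\<^sup>2"])
    fix s x assume s: "s \<in> {0..t}"
    show "((\<lambda>t. - P t f x) has_real_derivative - L (P s f) x) (at s within {0..t})"
      using s by (intro DERIV_minus DERIV_subset[OF P_derivative[OF f(1)]]) auto
    show "- L (P s f) x \<le> L (\<lambda>x. - P s f x) x"
      using laplacian_scale[of "-1" "P s f" x] by simp
  next
    fix s and F :: "'v set" assume s: "s \<in> {0..t}" and F: "finite F"
    have "(\<Sum>x\<in>F. m x * (P s f x)\<^sup>2) \<le> (l2_norm G (P s f))\<^sup>2"
      using s by (intro finite_sum_le_l2_norm P_l2 f F) auto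
    also have "\<dots> \<le> (l2_norm G f)\<^sup>2"
      using s by (intro power_mono P_contraction f) auto
    finally show "(\<Sum>x\<in>F. m x * (- P s f x)\<^sup>2) \<le> (l2_norm G f)\<^sup>2" by simp
  qed (use f P_0 in simp)
  then show ?thesis by simp
qed

end

section \<open>The Duhamel term\<close>

lemma integral_Icc_reflect:
  fixes h :: "real \<Rightarrow> real"
  shows "integral {0..t} (\<lambda>s. h (t - s)) = integral {0..t} h"
proof -
  have "integral {0..t} (\<lambda>s. h (t - s)) = integral {-t..-0} (\<lambda>s. h (s + t))"
    using Henstock_Kurzweil_Integration.integral_reflect_real[of t 0 "\<lambda>s. h (t - s)"] by (simp add: add.commute)
  also have "\<dots> = integral {0..t} h"
    using integral_shift_real_ivl[of 0 t t h] by simp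
  finally show ?thesis .
qed

text \<open>Here t enters through the upper end and through the first argument of A. Data of A are
  one-sided because the semigroup is controlled for nonnegative times only, and s = t lies exactly
  on that boundary.\<close>

lemma leibniz_triangle:
  fixes A B :: "real \<Rightarrow> real \<Rightarrow> real"
  assumes contA: "continuous_on ({0..} \<times> {0..}) (\<lambda>(\<tau>, s). A \<tau> s)"
    and contB: "continuous_on ({0..} \<times> {0..}) (\<lambda>(\<tau>, s). B \<tau> s)"
    and der: "\<And>\<tau> s. 0 \<le> \<tau> \<Longrightarrow> 0 \<le> s \<Longrightarrow>
      ((\<lambda>\<tau>. A \<tau> s) has_real_derivative B \<tau> s) (at \<tau> within {0..})"
    and t: "0 \<le> t"
  shows "((\<lambda>t. integral {0..t} (\<lambda>s. A (t - s) s)) has_real_derivative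
    A 0 t + integral {0..t} (\<lambda>s. B (t - s) s)) (at t within {0..})"
proof -
  \<comment> \<open>a differentiable extension to negative first arguments separates the two roles of \<open>t\<close>\<close>
  define A' where "A' \<tau> s = A (max 0 \<tau>) s + min \<tau> 0 * B 0 s" for \<tau> s
  define B' where "B' \<tau> s = B (max 0 \<tau>) s" for \<tau> s
  have cB: "continuous_on (S \<times> {0..}) (\<lambda>(\<tau>, s). B (max 0 \<tau>) s)" for S
    using continuous_on_compose2[OF contB, of "S \<times> {0..}" "\<lambda>(\<tau>, s). (max 0 \<tau>, s)"]
    by (force simp: case_prod_unfold intro!: continuous_intros)
  have cA: "continuous_on (S \<times> {0..}) (\<lambda>(\<tau>, s). A (max 0 \<tau>) s)" for S
    using continuous_on_compose2[OF contA, of "S \<times> {0..}" "\<lambda>(\<tau>, s). (max 0 \<tau>, s)"]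
    by (force simp: case_prod_unfold intro!: continuous_intros)
  have cB0: "continuous_on (S \<times> {0..}) (\<lambda>(\<tau> :: real, s). B 0 s)" for S
    using continuous_on_compose2[OF contB, of "S \<times> {0..}" "\<lambda>(\<tau>, s). (0, s)"]
    by (force simp: case_prod_unfold intro!: continuous_intros)
  have contA': "continuous_on (S \<times> {0..}) (\<lambda>(\<tau>, s). A' \<tau> s)" for S
    using cA[of S] cB0[of S] unfolding A'_def case_prod_unfold by (intro continuous_intros)
  have contB': "continuous_on (S \<times> {0..}) (\<lambda>(\<tau>, s). B' \<tau> s)" for S
    using cB[of S] unfolding B'_def .
  have der': "((\<lambda>\<tau>. A' \<tau> s) has_real_derivative B' \<tau> s) (at \<tau>)" if s: "0 \<le> s" for \<tau> s
  proof -
    have right: "((\<lambda>\<tau>. A' \<tau> s) has_real_derivative B' \<tau> s) (at \<tau> within {0..})" if "0 \<le> \<tau>"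
      by (rule has_field_derivative_transform_within[of "\<lambda>\<tau>. A \<tau> s" _ _ _ 1])
         (use der[OF that s] that in \<open>auto simp: A'_def B'_def\<close>)
    have left: "((\<lambda>\<tau>. A' \<tau> s) has_real_derivative B' \<tau> s) (at \<tau> within {..0})" if "\<tau> \<le> 0"
    proof (rule has_field_derivative_transform_within[of "\<lambda>\<tau>. A 0 s + \<tau> * B 0 s" _ _ _ 1])
      show "((\<lambda>\<tau>. A 0 s + \<tau> * B 0 s) has_real_derivative B' \<tau> s) (at \<tau> within {..0})"
        using that by (auto intro!: derivative_eq_intros simp: B'_def)
    qed (use that in \<open>auto simp: A'_def\<close>)
    consider "\<tau> > 0" | "\<tau> < 0" | "\<tau> = 0" by linarith
    then show ?thesis
    proof cases
      case 1
      then have "at \<tau> within {0..} = at \<tau>" by (intro at_within_interior) simp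
      then show ?thesis using right 1 by simp
    next
      case 2
      then have "at \<tau> within {..0} = at \<tau>" by (intro at_within_interior) simp
      then show ?thesis using left 2 by simp
    next
      \<comment> \<open>At 0 the left and right quotients share the limit \<open>B 0 s\<close>, and
        the full filter at 0 is the supremum of the two one-sided filters.\<close>
      case 3
      have "{0..} \<union> {..0} = (UNIV :: real set)" by auto
      then have "at \<tau> = sup (at \<tau> within {0..}) (at \<tau> within {..0})"
        by (metis at_within_union)
      then show ?thesis
        using left right 3 unfolding has_field_derivative_iff by (simp add: filterlim_sup)
    qed
  qed
  have cshift: "continuous_on (S \<times> {0..}) (\<lambda>(u, s). A' (u - s) s)"
      "continuous_on (S \<times> {0..}) (\<lambda>(u, s). B' (u - s) s)" for S
    using continuous_on_compose2[OF contA'[of UNIV], of "S \<times> {0..}" "\<lambda>(u, s). (u - s, s)"]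
      continuous_on_compose2[OF contB'[of UNIV], of "S \<times> {0..}" "\<lambda>(u, s). (u - s, s)"]
    by (force simp: case_prod_unfold intro!: continuous_intros)+
  have cline: "continuous_on {0..r} (\<lambda>s. A' (u - s) s)" for u r
    using continuous_on_compose2[OF cshift(1)[of UNIV], of "{0..r}" "\<lambda>s. (u, s)"]
    by (force intro!: continuous_intros)
  define F where "F u r = integral {0..r} (\<lambda>s. A' (u - s) s)" for u r
  have Fu: "((\<lambda>u. F u t) has_real_derivative integral {0..t} (\<lambda>s. B' (t - s) s)) (at t)"
    unfolding F_def cbox_interval[symmetric]
  proof (rule leibniz_rule_field_derivative)
    fix u s assume "s \<in> cbox 0 t"
    then have s: "0 \<le> s" by simp
    show "((\<lambda>u. A' (u - s) s) has_real_derivative B' (u - s) s) (at u)"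
    proof -
      have "((\<lambda>u. u - s) has_real_derivative 1) (at u)"
        by (auto intro!: derivative_eq_intros)
      from DERIV_chain2[where f = "\<lambda>\<tau>. A' \<tau> s", OF der'[OF s] this] show ?thesis by simp
    qed
  next
    fix u show "(\<lambda>s. A' (u - s) s) integrable_on cbox 0 t"
      using integrable_continuous_real[OF cline] by simp
  next
    show "continuous_on (UNIV \<times> cbox 0 t) (\<lambda>(u, s). B' (u - s) s)"
      by (rule continuous_on_subset[OF cshift(2)[of UNIV]]) auto
  qed auto
  have Fr: "((\<lambda>r. F u r) has_real_derivative A' (u - r) r) (at r within {0..})" if "0 \<le> r" for u r
  proof -
    have "((\<lambda>r. F u r) has_real_derivative A' (u - r) r) (at r within {0..r + 1})"
      unfolding F_def by (rule integral_has_real_derivative[OF cline]) (use that in auto)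
    moreover have "at r within {0..r + 1} = at r within {0..}"
      by (rule at_within_nhd[of _ "{..<r + 1}"]) auto
    ultimately show ?thesis by simp
  qed
  have "((\<lambda>(u, r). F u r) has_derivative
      (\<lambda>(h, k). integral {0..t} (\<lambda>s. B' (t - s) s) * h + blinfun_apply (blinfun_mult_right (A' (t - t) t)) k))
      (at (t, t) within UNIV \<times> {0..})"
  \<comment> \<open>A joint derivative follows from the partial derivative in u at the base point
    together with the partial derivative in r at all points, continuous at the base point.\<close>
  proof (rule has_derivative_partialsI[where fy = "\<lambda>u r. blinfun_mult_right (A' (u - r) r)"])
    show "((\<lambda>u. F u t) has_derivative (*) (integral {0..t} (\<lambda>s. B' (t - s) s))) (at t within UNIV)"
      using Fu by (simp add: has_field_derivative_def)
    show "((\<lambda>r. F u r) has_derivative blinfun_apply (blinfun_mult_right (A' (u - r) r))) (at r within {0..})"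
      if "r \<in> {0..}" for u r
      using Fr[of r u] that by (simp add: has_field_derivative_def)
    have "continuous_on (UNIV \<times> {0..}) (\<lambda>z. blinfun_mult_right ((\<lambda>(u, s). A' (u - s) s) z))"
      by (rule bounded_linear.continuous_on[OF bounded_linear_blinfun_mult_right cshift(1)])
    then show "continuous (at (t, t) within UNIV \<times> {0..}) (\<lambda>(u, r). blinfun_mult_right (A' (u - r) r))"
      using t by (simp add: continuous_on_eq_continuous_within case_prod_unfold)
  qed (use t in auto)
  \<comment> \<open>Restricted to the diagonal, this can be composed with t -> (t, t).\<close>
  then have "((\<lambda>(u, r). F u r) has_derivative
      (\<lambda>(h, k). integral {0..t} (\<lambda>s. B' (t - s) s) * h + A' 0 t * k))
      (at (t, t) within (\<lambda>t. (t, t)) ` {0..})"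
    by (auto elim!: has_derivative_subset)
  from has_derivative_in_compose[OF has_derivative_Pair[OF has_derivative_ident has_derivative_ident] this]
  have "((\<lambda>t. F t t) has_derivative
      (\<lambda>h. integral {0..t} (\<lambda>s. B' (t - s) s) * h + A' 0 t * h)) (at t within {0..})"
    by simp
  also have "(\<lambda>h. integral {0..t} (\<lambda>s. B' (t - s) s) * h + A' 0 t * h)
      = (*) (A' 0 t + integral {0..t} (\<lambda>s. B' (t - s) s))"
    by (simp add: fun_eq_iff algebra_simps)
  finally have "((\<lambda>t. F t t) has_real_derivative A' 0 t + integral {0..t} (\<lambda>s. B' (t - s) s)) (at t within {0..})"
    by (simp add: has_field_derivative_def)
  moreover have "A' 0 t = A 0 t" by (simp add: A'_def)
  moreover have "integral {0..t} (\<lambda>s. B' (t - s) s) = integral {0..t} (\<lambda>s. B (t - s) s)"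
    by (rule integral_cong) (simp add: B'_def)
  moreover have "F u u = integral {0..u} (\<lambda>s. A (u - s) s)" for u
    unfolding F_def by (rule integral_cong) (simp add: A'_def)
  ultimately show ?thesis by simp
qed

section \<open>Time continuity of the source term\<close>

context nondegenerate_graph begin

lemma power2_diff_in_l1:
  assumes "f \<in> l2 G" "g \<in> l2 G"
  shows "(\<lambda>x. (f x)\<^sup>2 - (g x)\<^sup>2) \<in> weighted_l1"
  using l1_diff_le(1)[OF power2_in_l1(1)[OF l2_diff[OF assms]] power2_in_l1(1)[OF assms(2)] _ _
      power2_diff_le[OF zero_less_one]] by simp

lemma l2_norm_power2_tendsto:
  assumes "\<forall>\<^sub>F i in F. \<alpha> i \<in> l2 G" "\<beta> \<in> l2 G"
    and lim: "((\<lambda>i. l2_norm G (\<lambda>x. \<alpha> i x - \<beta> x)) \<longlongrightarrow> 0) F"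
  shows "((\<lambda>i. l2_norm G (\<lambda>x. (\<alpha> i x)\<^sup>2 - (\<beta> x)\<^sup>2)) \<longlongrightarrow> 0) F"
proof (rule tendsto_sandwich[OF _ _ tendsto_const])
  show "((\<lambda>i. l1_norm (\<lambda>x. (\<alpha> i x)\<^sup>2 - (\<beta> x)\<^sup>2) / sqrt m0) \<longlongrightarrow> 0) F"
    using tendsto_divide[OF l1_norm_power2_tendsto[OF assms] tendsto_const, of "sqrt m0"] m0_pos by simp
  show "\<forall>\<^sub>F i in F. l2_norm G (\<lambda>x. (\<alpha> i x)\<^sup>2 - (\<beta> x)\<^sup>2)
      \<le> l1_norm (\<lambda>x. (\<alpha> i x)\<^sup>2 - (\<beta> x)\<^sup>2) / sqrt m0"
    using assms(1) by eventually_elim (rule l1_imp_l2(2)[OF power2_diff_in_l1[OF _ assms(2)]])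
qed (auto intro!: always_eventually)

end

context heat_graph begin

text \<open>Change u first and the semigroup time second. Contraction makes the first error uniform
  in the semigroup time, and the second one involves the fixed function \<open>u s\<close>
  only.\<close>

lemma P_joint_continuous:
  fixes u :: "real \<Rightarrow> 'v \<Rightarrow> real"
  assumes u: "\<And>s. 0 \<le> s \<Longrightarrow> u s \<in> l2 G"
    and cont: "\<And>s. 0 \<le> s \<Longrightarrow> ((\<lambda>r. l2_norm G (\<lambda>x. u r x - u s x)) \<longlongrightarrow> 0) (at s within {0..})"
  shows "continuous_on ({0..} \<times> {0..}) (\<lambda>(\<tau>, s). P \<tau> (u s) x)"
proof (rule continuous_on_eq_continuous_within[THEN iffD2], rule ballI)
  fix z :: "real \<times> real" assume z: "z \<in> {0..} \<times> {0..}"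
  define \<tau> s where "\<tau> = fst z" and "s = snd z"
  have [simp]: "0 \<le> \<tau>" "0 \<le> s" using z by (auto simp: \<tau>_def s_def)
  define \<phi> where "\<phi> r = l2_norm G (\<lambda>x. u r x - u s x)" for r
  define \<psi> where "\<psi> r = l2_norm G (\<lambda>x. P r (u s) x - P \<tau> (u s) x)" for r
  have [simp]: "\<phi> s = 0" "\<psi> \<tau> = 0" by (simp_all add: \<phi>_def \<psi>_def l2_norm_def l2_inner_def)
  have "continuous (at (snd z) within snd ` ({0..} \<times> {0..})) \<phi>"
    by (rule continuous_within_subset[of _ "{0..}"])
      (use cont[of s] in \<open>auto simp: continuous_within \<phi>_def[symmetric] s_def[symmetric]\<close>)
  from continuous_within_compose[OF linear_continuous_within[OF bounded_linear_snd] this]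
  have 1: "((\<lambda>w. \<phi> (snd w)) \<longlongrightarrow> 0) (at z within {0..} \<times> {0..})"
    unfolding continuous_within o_def s_def[symmetric] by simp
  have "continuous (at (fst z) within fst ` ({0..} \<times> {0..})) \<psi>"
    by (rule continuous_within_subset[of _ "{0..}"])
      (use P_continuous[of \<tau> "u s"] u in \<open>auto simp: continuous_within \<psi>_def[symmetric] \<tau>_def[symmetric]\<close>)
  from continuous_within_compose[OF linear_continuous_within[OF bounded_linear_fst] this]
  have 2: "((\<lambda>w. \<psi> (fst w)) \<longlongrightarrow> 0) (at z within {0..} \<times> {0..})"
    unfolding continuous_within o_def \<tau>_def[symmetric] by simp
  have "((\<lambda>w. P (fst w) (u (snd w)) x - P \<tau> (u s) x) \<longlongrightarrow> 0) (at z within {0..} \<times> {0..})"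
  proof (rule Lim_null_comparison)
    show "((\<lambda>w. (\<phi> (snd w) + \<psi> (fst w)) / sqrt m0) \<longlongrightarrow> 0) (at z within {0..} \<times> {0..})"
      using tendsto_divide[OF tendsto_add[OF 1 2] tendsto_const, of "sqrt m0"] m0_pos by simp
    show "\<forall>\<^sub>F w in at z within {0..} \<times> {0..}. norm (P (fst w) (u (snd w)) x - P \<tau> (u s) x)
        \<le> (\<phi> (snd w) + \<psi> (fst w)) / sqrt m0"
      unfolding eventually_at_filter
    proof (intro always_eventually allI impI)
      fix w :: "real \<times> real" assume "w \<in> {0..} \<times> {0..}"
      then have w: "0 \<le> fst w" "0 \<le> snd w" by auto
      have "P (fst w) (u (snd w)) x - P (fst w) (u s) x = P (fst w) (\<lambda>x. u (snd w) x - u s x) x"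
        using P_diff[of "fst w" "u (snd w)" "u s"] u w by simp
      also have "\<bar>\<dots>\<bar> \<le> \<phi> (snd w) / sqrt m0"
        unfolding \<phi>_def using u w by (intro abs_P_le_l2 l2_diff) auto
      finally have "\<bar>P (fst w) (u (snd w)) x - P (fst w) (u s) x\<bar> \<le> \<phi> (snd w) / sqrt m0" .
      moreover have "\<bar>P (fst w) (u s) x - P \<tau> (u s) x\<bar> \<le> \<psi> (fst w) / sqrt m0"
        unfolding \<psi>_def using u w
        by (intro abs_le_l2_norm[of "\<lambda>x. P (fst w) (u s) x - P \<tau> (u s) x"] l2_diff P_l2) auto
      ultimately show "norm (P (fst w) (u (snd w)) x - P \<tau> (u s) x)
          \<le> (\<phi> (snd w) + \<psi> (fst w)) / sqrt m0"
        by (simp add: add_divide_distrib)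
    qed
  qed
  then show "continuous (at z within {0..} \<times> {0..}) (\<lambda>(\<tau>, s). P \<tau> (u s) x)"
    by (simp add: continuous_within LIM_zero_iff case_prod_unfold \<tau>_def s_def)
qed

definition source :: "('v \<Rightarrow> real) \<Rightarrow> real \<Rightarrow> 'v \<Rightarrow> real" where
  "source f s = (\<lambda>y. (L (P s f) y)\<^sup>2)"

text \<open>The integral of the estimate after s -> t - s. The source then depends on the
  integration variable alone, so differentiation in t acts on the semigroup and on the end point, as
  in Duhamel's formula.\<close>

definition duhamel :: "real \<Rightarrow> ('v \<Rightarrow> real) \<Rightarrow> real \<Rightarrow> 'v \<Rightarrow> real" where
  "duhamel K f t x = integral {0..t} (\<lambda>s. exp (- 2 * K * (t - s)) * P (t - s) (source f s) x)"

lemma source_l2: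
  assumes "f \<in> C0" "0 \<le> s"
  shows "source f s \<in> l2 G" "l2_norm G (source f s) \<le> (l2_norm G (L f))\<^sup>2 / sqrt m0"
proof -
  have l: "L f \<in> l2 G" using assms(1) laplacian_C0 C0_subset_l2 by auto
  have s: "source f s = (\<lambda>y. (P s (L f) y)\<^sup>2)"
    by (simp add: source_def P_laplacian_commute[OF assms])
  note 1 = power2_in_l1[OF P_l2[OF assms(2) l]]
  show "source f s \<in> l2 G" unfolding s by (rule l1_imp_l2(1)[OF 1(1)])
  have "l2_norm G (source f s) \<le> (l2_norm G (P s (L f)))\<^sup>2 / sqrt m0"
    unfolding s using l1_imp_l2(2)[OF 1(1)] 1(2) by simp
  also have "\<dots> \<le> (l2_norm G (L f))\<^sup>2 / sqrt m0"
    using m0_pos by (intro divide_right_mono power_mono P_contraction l assms(2)) auto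
  finally show "l2_norm G (source f s) \<le> (l2_norm G (L f))\<^sup>2 / sqrt m0" .
qed

text \<open>On \<open>C0\<close> the Laplacian commutes with P, so the source is the square of the
  orbit of Lf, which is norm continuous up to time 0.\<close>

lemma source_joint_continuous:
  assumes "f \<in> C0"
  shows "continuous_on ({0..} \<times> {0..}) (\<lambda>(\<tau>, s). P \<tau> (source f s) x)"
proof (rule P_joint_continuous)
  have l: "L f \<in> l2 G" using assms(1) laplacian_C0 C0_subset_l2 by auto
  fix s :: real assume s: "0 \<le> s"
  show "source f s \<in> l2 G" by (rule source_l2[OF assms s])
  have "((\<lambda>r. l2_norm G (\<lambda>x. (P r (L f) x)\<^sup>2 - (P s (L f) x)\<^sup>2)) \<longlongrightarrow> 0) (at s within {0..})"
    by (rule l2_norm_power2_tendsto[OF _ P_l2[OF s l] P_continuous[OF s l]])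
      (auto simp: eventually_at_filter P_l2 l intro!: always_eventually)
  then show "((\<lambda>r. l2_norm G (\<lambda>x. source f r x - source f s x)) \<longlongrightarrow> 0) (at s within {0..})"
    by (rule Lim_transform_within[OF _ zero_less_one]) (use s assms in \<open>auto simp: source_def P_laplacian_commute\<close>)
qed

lemma continuous_on_source:
  assumes "f \<in> C0"
  shows "continuous_on {0..t} (\<lambda>s. exp (- 2 * K * (t - s)) * P (t - s) (source f s) x)"
    "continuous_on {0..t} (\<lambda>s. exp (- 2 * K * s) * P s (source f (t - s)) x)"
  using continuous_on_compose2[OF source_joint_continuous[OF assms], of "{0..t}" "\<lambda>s. (t - s, s)"]
    continuous_on_compose2[OF source_joint_continuous[OF assms], of "{0..t}" "\<lambda>s. (s, t - s)"]
  by (force intro!: continuous_intros)+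

lemma set_integral_eq_duhamel:
  assumes "f \<in> C0" "0 \<le> t"
  shows "set_integrable lborel {0<..<t} (\<lambda>s. exp (- 2 * K * s) * P s (source f (t - s)) x)"
    and "(LINT s:{0<..<t}|lborel. exp (- 2 * K * s) * P s (source f (t - s)) x) = duhamel K f t x"
proof -
  let ?h = "\<lambda>s. exp (- 2 * K * s) * P s (source f (t - s)) x"
  show 1: "set_integrable lborel {0<..<t} ?h"
    by (rule set_integrable_subset[OF borel_integrable_atLeastAtMost'[OF continuous_on_source(2)[OF assms(1), of t]]]) auto
  have "(LINT s:{0<..<t}|lborel. ?h s) = integral {0<..<t} ?h"
    by (rule set_borel_integral_eq_integral(2)[OF 1])
  also have "\<dots> = integral {0..t} ?h" by (rule integral_open_interval_real[symmetric])
  also have "\<dots> = integral {0..t} (\<lambda>s. ?h (t - s))" by (rule integral_Icc_reflect[symmetric])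
  finally show "(LINT s:{0<..<t}|lborel. ?h s) = duhamel K f t x"
    by (simp add: duhamel_def)
qed

lemma has_integral_duhamel:
  assumes "f \<in> C0"
  shows "((\<lambda>s. exp (- 2 * K * (t - s)) * P (t - s) (source f s) x) has_integral duhamel K f t x) {0..t}"
  unfolding duhamel_def
  by (intro integrable_integral integrable_continuous_real continuous_on_source assms)

lemma duhamel_derivative:
  assumes f: "f \<in> C0" and t: "0 \<le> t"
  shows "((\<lambda>t. duhamel K f t x) has_real_derivative
    source f t x + L (duhamel K f t) x - 2 * K * duhamel K f t x) (at t within {0..})"
proof -
  define A where "A y \<tau> s = exp (- 2 * K * \<tau>) * P \<tau> (source f s) y" for y \<tau> s
  \<comment> \<open>Spelled out as a finite sum over neighbours, so that joint continuity and
    integration reduce to those of the single terms \<open>A y\<close>.\<close>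
  define B where "B \<tau> s = (\<Sum>y\<in>nbrs x. w x y * (A y \<tau> s - A x \<tau> s)) / m x - 2 * K * A x \<tau> s" for \<tau> s
  have contA: "continuous_on ({0..} \<times> {0..}) (\<lambda>(\<tau>, s). A y \<tau> s)" for y
    using source_joint_continuous[OF f, of y] unfolding A_def case_prod_unfold
    by (intro continuous_intros)
  have contB: "continuous_on ({0..} \<times> {0..}) (\<lambda>(\<tau>, s). B \<tau> s)"
    using contA unfolding B_def case_prod_unfold by (intro continuous_intros) auto
  have derA: "((\<lambda>\<tau>. A x \<tau> s) has_real_derivative B \<tau> s) (at \<tau> within {0..})"
    if "0 \<le> \<tau>" "0 \<le> s" for \<tau> s
  proof -
    have "B \<tau> s = exp (- 2 * K * \<tau>) * L (P \<tau> (source f s)) x - 2 * K * A x \<tau> s"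
      by (simp add: B_def A_def laplacian_def sum_distrib_left mult.left_commute flip: right_diff_distrib)
    then show ?thesis
      unfolding A_def
      by (auto intro!: derivative_eq_intros P_derivative source_l2 f that simp: algebra_simps)
  qed
  have "((\<lambda>s. B (t - s) s) has_integral
      ((\<Sum>y\<in>nbrs x. w x y * (duhamel K f t y - duhamel K f t x)) / m x - 2 * K * duhamel K f t x)) {0..t}"
    unfolding B_def A_def
    by (intro has_integral_diff has_integral_divide has_integral_sum has_integral_mult_right
        has_integral_duhamel f finite_nbrs)
  then have "integral {0..t} (\<lambda>s. B (t - s) s) = L (duhamel K f t) x - 2 * K * duhamel K f t x"
    by (simp add: integral_unique laplacian_def)
  moreover have "A x 0 t = source f t x" by (simp add: A_def P_0 source_l2[OF f t])
  moreover have "duhamel K f u x = integral {0..u} (\<lambda>s. A x (u - s) s)" for u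
    by (simp add: duhamel_def A_def)
  ultimately show ?thesis
    using leibniz_triangle[OF contA[of x] contB derA t] by (simp add: add_diff_eq)
qed

end

section \<open>Finitely supported functions\<close>

context heat_graph begin

text \<open>Minkowski's integral inequality by duality: pair with the restriction \<phi> of the
  Duhamel term to a finite set, so that only a finite sum is exchanged with the integral, apply
  Cauchy-Schwarz under the integral, and divide by the norm of \<phi>.\<close>

lemma duhamel_l2_bound:
  assumes f: "f \<in> C0" and t: "0 \<le> t"
  shows "duhamel K f t \<in> l2 G"
    "l2_norm G (duhamel K f t) \<le> exp (2 * \<bar>K\<bar> * t) * ((l2_norm G (L f))\<^sup>2 / sqrt m0) * t"
proof -
  let ?C = "(l2_norm G (L f))\<^sup>2 / sqrt m0"
  let ?c = "exp (2 * \<bar>K\<bar> * t) * ?C * t"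
  let ?D = "duhamel K f t"
  have c: "0 \<le> ?C" "0 \<le> ?c" using m0_pos t by auto
  have b: "(\<Sum>x\<in>F. m x * (?D x)\<^sup>2) \<le> ?c\<^sup>2" if F: "finite F" for F
  proof -
    define X where "X = (\<Sum>x\<in>F. m x * (?D x)\<^sup>2)"
    define \<phi> where "\<phi> x = (if x \<in> F then ?D x else 0)" for x
    have \<phi>: "\<phi> \<in> l2 G" using F C0_subset_l2 by (auto simp: C0_def \<phi>_def)
    have inner: "l2_inner G \<phi> g = (\<Sum>x\<in>F. m x * ?D x * g x)" for g
      unfolding l2_inner_def by (subst infsum_finite_support[OF F]) (auto simp: \<phi>_def)
    have "l2_inner G \<phi> \<phi> = X"
      unfolding inner X_def by (rule sum.cong) (auto simp: \<phi>_def power2_eq_square)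
    then have norm: "(l2_norm G \<phi>)\<^sup>2 = X" by (simp add: l2_norm_power2)
    have "((\<lambda>s. \<Sum>x\<in>F. m x * ?D x * (exp (- 2 * K * (t - s)) * P (t - s) (source f s) x))
        has_integral (\<Sum>x\<in>F. m x * ?D x * ?D x)) {0..t}"
      by (intro has_integral_sum F has_integral_mult_right has_integral_duhamel f)
    then have int: "((\<lambda>s. exp (- 2 * K * (t - s)) * l2_inner G \<phi> (P (t - s) (source f s)))
        has_integral X) {0..t}"
      by (simp add: inner X_def sum_distrib_left power2_eq_square ac_simps)
    have "X \<le> exp (2 * \<bar>K\<bar> * t) * (l2_norm G \<phi> * ?C) * t"
    proof -
      have "norm X \<le> exp (2 * \<bar>K\<bar> * t) * (l2_norm G \<phi> * ?C) * Henstock_Kurzweil_Integration.content {0..t}"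
      proof (rule has_integral_bound_real[OF _ finite.emptyI int])
        fix s assume "s \<in> {0..t} - {}"
        then have s: "s \<in> {0..t}" by simp
        have "- 2 * K * (t - s) \<le> 2 * \<bar>K\<bar> * t"
        proof -
          have "- K * (t - s) \<le> \<bar>K\<bar> * (t - s)" using s by (intro mult_right_mono) auto
          also have "\<dots> \<le> \<bar>K\<bar> * t" using s by (intro mult_left_mono) auto
          finally show ?thesis by linarith
        qed
        then have e: "exp (- 2 * K * (t - s)) \<le> exp (2 * \<bar>K\<bar> * t)" by simp
        have i: "\<bar>l2_inner G \<phi> (P (t - s) (source f s))\<bar> \<le> l2_norm G \<phi> * ?C"
        proof -
          have "\<bar>l2_inner G \<phi> (P (t - s) (source f s))\<bar>
              \<le> l2_norm G \<phi> * l2_norm G (P (t - s) (source f s))"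
            using s by (intro Cauchy_Schwarz_l2 P_l2 \<phi> source_l2 f) auto
          also have "\<dots> \<le> l2_norm G \<phi> * l2_norm G (source f s)"
            using s by (intro mult_left_mono P_contraction source_l2 f) auto
          also have "\<dots> \<le> l2_norm G \<phi> * ?C"
            using s by (intro mult_left_mono source_l2 f) auto
          finally show ?thesis .
        qed
        show "norm (exp (- 2 * K * (t - s)) * l2_inner G \<phi> (P (t - s) (source f s)))
            \<le> exp (2 * \<bar>K\<bar> * t) * (l2_norm G \<phi> * ?C)"
          unfolding real_norm_def abs_mult abs_exp_cancel by (rule mult_mono[OF e i]) auto
      qed (use m0_pos in simp)
      then show ?thesis using t by simp
    qed
    then have le: "(l2_norm G \<phi>)\<^sup>2 \<le> ?c * l2_norm G \<phi>" by (simp add: norm ac_simps)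
    have "l2_norm G \<phi> \<le> ?c"
    proof (cases "l2_norm G \<phi> = 0")
      case False
      then have "0 < l2_norm G \<phi>" using l2_norm_nonneg[of \<phi>] by linarith
      moreover have "l2_norm G \<phi> * l2_norm G \<phi> \<le> ?c * l2_norm G \<phi>"
        using le by (simp only: power2_eq_square)
      ultimately show ?thesis by (rule mult_right_le_imp_le[rotated])
    qed (use c in simp)
    then have "(l2_norm G \<phi>)\<^sup>2 \<le> ?c\<^sup>2" by (intro power_mono) auto
    then show ?thesis unfolding norm X_def .
  qed
  from l2_bounded_finite_sums[OF b c(2)] show "?D \<in> l2 G" "l2_norm G ?D \<le> ?c" by auto
qed

text \<open>The function v of the overview, with the integral in its Duhamel form.\<close>

definition deficit :: "real \<Rightarrow> real \<Rightarrow> ('v \<Rightarrow> real) \<Rightarrow> real \<Rightarrow> 'v \<Rightarrow> real" where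
  "deficit K n f t x = Gamma1 G (P t f) x
    - (exp (- 2 * K * t) * P t (Gamma1 G f) x - 2 / n * duhamel K f t x)"

section \<open>Size and evolution of the deficit\<close>

lemma Gamma1_P_l2:
  assumes "f \<in> C0" "0 \<le> t"
  shows "Gamma1 G (P t f) \<in> l2 G" "l2_norm G (Gamma1 G (P t f)) \<le> l2_norm G (L f) * l2_norm G f / sqrt m0"
proof -
  note 1 = Gamma1_l1[OF P_finite_energy[OF assms]]
  show "Gamma1 G (P t f) \<in> l2 G" by (rule l1_imp_l2(1)[OF 1(1)])
  have "l2_norm G (Gamma1 G (P t f)) \<le> dirichlet_form G (P t f) (P t f) / sqrt m0"
    using l1_imp_l2(2)[OF 1(1)] 1(2) by simp
  also have "\<dots> \<le> l2_norm G (L f) * l2_norm G f / sqrt m0"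
    using m0_pos by (intro divide_right_mono dirichlet_P_le assms) auto
  finally show "l2_norm G (Gamma1 G (P t f)) \<le> l2_norm G (L f) * l2_norm G f / sqrt m0" .
qed

lemma Gamma1_C0_l2: "f \<in> C0 \<Longrightarrow> Gamma1 G f \<in> l2 G"
  using l1_imp_l2(1)[OF Gamma1_l1(1)[OF C0_finite_energy]] .

lemma Gamma1_P_derivative:
  assumes "f \<in> l2 G" "0 \<le> t"
  shows "((\<lambda>t. Gamma1 G (P t f) x) has_real_derivative 2 * Gamma_form G (P t f) (L (P t f)) x)
    (at t within {0..})"
proof -
  have 1: "Gamma_form G g h x = (\<Sum>y\<in>nbrs x. w x y * ((g y - g x) * (h y - h x))) / (2 * m x)" for g h
    using Gamma_eq_sum[of x g h] by (simp add: field_simps)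
  \<comment> \<open>The two equal summands are kept apart to match the shape in which the product
    rule delivers the derivative of a square.\<close>
  have eq: "2 * Gamma_form G (P t f) (L (P t f)) x
    = (\<Sum>y\<in>nbrs x. w x y * ((L (P t f) y - L (P t f) x) * (P t f y - P t f x)
        + (L (P t f) y - L (P t f) x) * (P t f y - P t f x))) / (2 * m x)"
    unfolding 1 by (simp add: sum_distrib_left sum.distrib algebra_simps)
  show ?thesis
    unfolding eq unfolding 1
    by (intro DERIV_cdivide DERIV_sum DERIV_cmult DERIV_mult DERIV_diff P_derivative assms)
qed

text \<open>By definition of Gamma2, 2 Gamma(u, Lu) = L Gamma(u) - 2 Gamma2(u); the remaining terms
  complete L and -2K to act on the whole deficit. The identity holds independently of CD and
  includes t = 0, hence serves both directions.\<close>

lemma deficit_derivative: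
  assumes f: "f \<in> C0" and t: "0 \<le> t"
  shows "((\<lambda>t. deficit K n f t x) has_real_derivative
    L (deficit K n f t) x - 2 * K * deficit K n f t x
      - 2 * (Gamma2 G (P t f) x - K * Gamma1 G (P t f) x - 1 / n * (L (P t f) x)\<^sup>2)) (at t within {0..})"
proof -
  have l: "f \<in> l2 G" using f C0_subset_l2 by auto
  let ?W = "\<lambda>t. P t (Gamma1 G f)"
  have "((\<lambda>t. deficit K n f t x) has_real_derivative
     2 * Gamma_form G (P t f) (L (P t f)) x
     - ((exp (- 2 * K * t) * L (?W t) x + (- 2 * K) * exp (- 2 * K * t) * ?W t x)
       - 2 / n * (source f t x + L (duhamel K f t) x - 2 * K * duhamel K f t x))) (at t within {0..})"
    unfolding deficit_def
  proof (intro DERIV_diff DERIV_cmult Gamma1_P_derivative duhamel_derivative l t f)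
    have "((\<lambda>t. exp (- 2 * K * t)) has_real_derivative (- 2 * K) * exp (- 2 * K * t)) (at t within {0..})"
      by (auto intro!: derivative_eq_intros)
    from DERIV_mult[OF this P_derivative[OF Gamma1_C0_l2[OF f] t, of x]]
    show "((\<lambda>t. exp (- 2 * K * t) * ?W t x) has_real_derivative
        exp (- 2 * K * t) * L (?W t) x + (- 2 * K) * exp (- 2 * K * t) * ?W t x) (at t within {0..})"
      by (simp add: algebra_simps)
  qed
  moreover have "L (deficit K n f t) x = L (Gamma1 G (P t f)) x
      - (exp (- 2 * K * t) * L (?W t) x - 2 / n * L (duhamel K f t) x)"
    unfolding deficit_def laplacian_diff laplacian_scale ..
  then have "2 * Gamma_form G (P t f) (L (P t f)) x
     - ((exp (- 2 * K * t) * L (?W t) x + (- 2 * K) * exp (- 2 * K * t) * ?W t x)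
       - 2 / n * (source f t x + L (duhamel K f t) x - 2 * K * duhamel K f t x))
     = L (deficit K n f t) x - 2 * K * deficit K n f t x
      - 2 * (Gamma2 G (P t f) x - K * Gamma1 G (P t f) x - 1 / n * (L (P t f) x)\<^sup>2)"
    by (simp add: deficit_def Gamma2_def source_def algebra_simps add_divide_distrib diff_divide_distrib)
  ultimately show ?thesis by (rule DERIV_cong)
qed

text \<open>Provides the time-uniform l2 bound under which the cut-off errors in the maximum
  principle vanish.\<close>

lemma deficit_l2_bound:
  assumes f: "f \<in> C0" and "n > 0"
  obtains C where "\<And>t. t \<in> {0..T} \<Longrightarrow> deficit K n f t \<in> l2 G"
    "\<And>t. t \<in> {0..T} \<Longrightarrow> l2_norm G (deficit K n f t) \<le> C"
proof -
  let ?a = "l2_norm G (L f) * l2_norm G f / sqrt m0"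
  let ?b = "exp (2 * \<bar>K\<bar> * T) * l2_norm G (Gamma1 G f)"
  let ?c = "2 / n * (exp (2 * \<bar>K\<bar> * T) * ((l2_norm G (L f))\<^sup>2 / sqrt m0) * T)"
  have "deficit K n f t \<in> l2 G \<and> l2_norm G (deficit K n f t) \<le> ?a + (?b + ?c)"
    if t: "t \<in> {0..T}" for t
  proof -
    have t0: "0 \<le> t" "t \<le> T" using t by auto
    let ?A = "Gamma1 G (P t f)"
    let ?B = "\<lambda>x. (- exp (- 2 * K * t)) * P t (Gamma1 G f) x"
    let ?D = "\<lambda>x. 2 / n * duhamel K f t x"
    have l: "?A \<in> l2 G" "?B \<in> l2 G" "?D \<in> l2 G"
      by (intro Gamma1_P_l2 f t0 l2_scale P_l2 Gamma1_C0_l2 duhamel_l2_bound)+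
    have eq: "deficit K n f t = (\<lambda>x. ?A x + (?B x + ?D x))" by (simp add: deficit_def fun_eq_iff)
    have 1: "deficit K n f t \<in> l2 G" unfolding eq by (intro l2_add l)
    have "l2_norm G (deficit K n f t) \<le> l2_norm G ?A + (l2_norm G ?B + l2_norm G ?D)"
      unfolding eq
      by (rule order_trans[OF l2_norm_triangle[OF l(1) l2_add[OF l(2,3)]]])
        (intro add_left_mono l2_norm_triangle l)
    also have "\<dots> \<le> ?a + (?b + ?c)"
    proof (intro add_mono)
      show "l2_norm G ?A \<le> ?a" by (rule Gamma1_P_l2(2)[OF f t0(1)])
      have "- K * t \<le> \<bar>K\<bar> * T"
        using t0 by (intro order_trans[OF mult_right_mono[of "- K" "\<bar>K\<bar>" t] mult_left_mono]) auto
      then have "- 2 * K * t \<le> 2 * \<bar>K\<bar> * T" by linarith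
      then have e: "exp (- 2 * K * t) \<le> exp (2 * \<bar>K\<bar> * T)" by simp
      show "l2_norm G ?B \<le> ?b"
        unfolding l2_norm_scale using e t0 by (intro mult_mono P_contraction Gamma1_C0_l2 f) auto
      have "l2_norm G ?D = 2 / n * l2_norm G (duhamel K f t)"
        unfolding l2_norm_scale using assms(2) by simp
      also have "\<dots> \<le> 2 / n * (exp (2 * \<bar>K\<bar> * t) * ((l2_norm G (L f))\<^sup>2 / sqrt m0) * t)"
        using assms(2) by (intro mult_left_mono duhamel_l2_bound f t0) auto
      also have "\<dots> \<le> ?c"
      proof -
        have "exp (2 * \<bar>K\<bar> * t) \<le> exp (2 * \<bar>K\<bar> * T)" using t0 by (simp add: mult_left_mono)
        then show ?thesis
          using assms(2) t0 m0_pos by (intro mult_left_mono mult_mono) auto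
      qed
      finally show "l2_norm G ?D \<le> ?c" .
    qed
    finally show ?thesis using 1 by simp
  qed
  then show ?thesis using that by blast
qed

lemma deficit_nonpos:
  assumes CD: "CD G K n" and "n > 0" and f: "f \<in> C0" and t: "0 \<le> t"
  shows "deficit K n f t x \<le> 0"
proof -
  obtain C where C: "\<And>s. s \<in> {0..t} \<Longrightarrow> deficit K n f s \<in> l2 G"
    "\<And>s. s \<in> {0..t} \<Longrightarrow> l2_norm G (deficit K n f s) \<le> C"
    using deficit_l2_bound[OF f assms(2), of t K] by blast
  show ?thesis
  proof (rule maximum_principle[OF complete t])
    fix s x assume s: "s \<in> {0..t}"
    show "((\<lambda>t. deficit K n f t x) has_real_derivative
      L (deficit K n f s) x - 2 * K * deficit K n f s x
      - 2 * (Gamma2 G (P s f) x - K * Gamma1 G (P s f) x - 1 / n * (L (P s f) x)\<^sup>2)) (at s within {0..t})"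
      by (rule DERIV_subset[OF deficit_derivative[OF f]]) (use s in auto)
    have "Gamma2 G (P s f) x \<ge> 1 / n * (L (P s f) x)\<^sup>2 + K * Gamma1 G (P s f) x"
      using CD by (simp add: CD_def)
    then show "L (deficit K n f s) x - 2 * K * deficit K n f s x
      - 2 * (Gamma2 G (P s f) x - K * Gamma1 G (P s f) x - 1 / n * (L (P s f) x)\<^sup>2)
      \<le> L (deficit K n f s) x + (- 2 * K) * deficit K n f s x" by simp
  next
    fix s and F :: "'v set" assume s: "s \<in> {0..t}" and F: "finite F"
    have "(\<Sum>x\<in>F. m x * (deficit K n f s x)\<^sup>2) \<le> (l2_norm G (deficit K n f s))\<^sup>2"
      by (intro finite_sum_le_l2_norm C s F)
    also have "\<dots> \<le> C\<^sup>2" by (intro power_mono C s) auto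
    finally show "(\<Sum>x\<in>F. m x * (deficit K n f s x)\<^sup>2) \<le> C\<^sup>2" .
  next
    fix x
    show "deficit K n f 0 x \<le> 0"
      using f C0_subset_l2 by (auto simp: deficit_def duhamel_def P_0 Gamma1_C0_l2)
  qed
qed

text \<open>Gamma2 iterates the Laplacian twice and therefore sees values within two steps of x
  only.\<close>

lemma Gamma2_cong:
  assumes "\<And>y. y \<in> nbhd (nbhd {x}) \<Longrightarrow> f y = g y"
  shows "Gamma2 G f x = Gamma2 G g x" "Gamma1 G f x = Gamma1 G g x" "L f x = L g x"
proof -
  have eq: "f y = g y" if "y \<in> nbhd {z}" "z \<in> nbhd {x}" for y z
    using assms that by (auto simp: nbhd_def)
  have Lc: "L h z = L h' z" if "\<And>y. y \<in> nbhd {z} \<Longrightarrow> h y = h' y" for h h' z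
    by (rule laplacian_cong) (use that in \<open>auto simp: nbhd_def\<close>)
  have self: "z \<in> nbhd {z}" for z by (simp add: nbhd_def)
  have L1: "L f z = L g z" if "z \<in> nbhd {x}" for z
    by (rule Lc) (use eq that in blast)
  have L2: "L (\<lambda>y. f y * f y) z = L (\<lambda>y. g y * g y) z" if "z \<in> nbhd {x}" for z
    by (rule Lc) (use eq that in auto)
  have G1: "Gamma1 G f z = Gamma1 G g z" if "z \<in> nbhd {x}" for z
    using L1[OF that] L2[OF that] eq[OF self that] by (simp add: Gamma_form_def)
  show "Gamma1 G f x = Gamma1 G g x" "L f x = L g x"
    by (rule G1[OF self], rule L1[OF self])
  have "L (Gamma1 G f) x = L (Gamma1 G g) x" by (rule Lc) (rule G1)
  moreover have "L (L f) x = L (L g) x" by (rule Lc) (rule L1)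
  moreover have "L (\<lambda>y. f y * L f y) x = L (\<lambda>y. g y * L g y) x"
    by (rule Lc) (use L1 eq[OF self] in auto)
  ultimately show "Gamma2 G f x = Gamma2 G g x"
    using L1[OF self] eq[OF self self] by (simp add: Gamma2_def Gamma_form_def[of G f "L f"] Gamma_form_def[of G g "L g"])
qed

lemma CD_if_deficit_nonpos:
  assumes "\<And>f t x. f \<in> C0 \<Longrightarrow> 0 < t \<Longrightarrow> deficit K n f t x \<le> 0"
  shows "CD G K n"
proof -
  have C0: "Gamma2 G f x \<ge> 1 / n * (L f x)\<^sup>2 + K * Gamma1 G f x" if f: "f \<in> C0" for f x
  proof -
    have l: "f \<in> l2 G" using f C0_subset_l2 by auto
    have zero: "deficit K n f 0 y = 0" for y
      using l f by (simp add: deficit_def duhamel_def P_0 Gamma1_C0_l2)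
    then have "deficit K n f 0 = (\<lambda>_. 0)" by auto
    then have "((\<lambda>t. deficit K n f t x) has_real_derivative
        - 2 * (Gamma2 G f x - K * Gamma1 G f x - 1 / n * (L f x)\<^sup>2)) (at 0 within {0..})"
      using deficit_derivative[OF f, of 0 K n x] l by (simp add: P_0 laplacian_def)
    \<comment> \<open>As the deficit is 0 at time 0, its difference quotient there is deficit / t,
      which has a sign for t > 0.\<close>
    then have "((\<lambda>t. deficit K n f t x / t) \<longlongrightarrow>
        - 2 * (Gamma2 G f x - K * Gamma1 G f x - 1 / n * (L f x)\<^sup>2)) (at 0 within {0..})"
      by (simp add: has_field_derivative_iff zero)
    moreover have "\<forall>\<^sub>F t in at 0 within {0..}. deficit K n f t x / t \<le> 0"
      unfolding eventually_at_filter using assms[OF f]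
      by (intro always_eventually) (auto simp: divide_le_0_iff)
    moreover have "at (0::real) within {0..} \<noteq> bot"
      by (simp add: at_within_Ici_at_right)
    ultimately have "- 2 * (Gamma2 G f x - K * Gamma1 G f x - 1 / n * (L f x)\<^sup>2) \<le> 0"
      by (intro tendsto_upperbound)
    then show ?thesis by simp
  qed
  show ?thesis
    unfolding CD_def
  proof (intro allI)
    fix f :: "'v \<Rightarrow> real" and x
    \<comment> \<open>The semigroup cannot be applied to an arbitrary f; cutting f off outside the
      two-step ball keeps all quantities of CD at x.\<close>
    define g where "g y = (if y \<in> nbhd (nbhd {x}) then f y else 0)" for y
    have "g \<in> C0" by (simp add: C0_def g_def finite_nbhd)
    from C0[OF this, of x] show "Gamma2 G f x \<ge> 1 / n * (L f x)\<^sup>2 + K * Gamma1 G f x"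
      using Gamma2_cong[of x f g] by (simp add: g_def)
  qed
qed

end

section \<open>Functions in the form domain\<close>

context nondegenerate_graph begin

lemma laplacian_tendsto:
  assumes "\<And>y. ((\<lambda>i. g i y) \<longlongrightarrow> h y) F"
  shows "((\<lambda>i. L (g i) x) \<longlongrightarrow> L h x) F"
  unfolding laplacian_def by (intro tendsto_intros assms) simp

lemma Gamma1_tendsto:
  assumes "\<And>y. ((\<lambda>i. g i y) \<longlongrightarrow> h y) F"
  shows "((\<lambda>i. Gamma1 G (g i) x) \<longlongrightarrow> Gamma1 G h x) F"
  unfolding Gamma_form_def by (intro tendsto_intros laplacian_tendsto assms) simp

lemma dirichlet_form_minus_commute:
  "dirichlet_form G (\<lambda>x. f x - g x) (\<lambda>x. f x - g x) = dirichlet_form G (\<lambda>x. g x - f x) (\<lambda>x. g x - f x)"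
proof -
  have "((f y - g y) - (f x - g x))\<^sup>2 = ((g y - f y) - (g x - f x))\<^sup>2" for x y
    by (simp add: power2_eq_square algebra_simps)
  then show ?thesis by (simp add: dirichlet_form_self)
qed

lemma form_domain_l2: "f \<in> form_domain G \<Longrightarrow> f \<in> l2 G"
  and form_domain_finite_energy: "f \<in> form_domain G \<Longrightarrow> f \<in> finite_energy G"
  by (auto simp: form_domain_def)

end

context heat_graph begin

lemma P_tendsto_l2:
  assumes "0 \<le> t" "\<And>i. g i \<in> l2 G" "h \<in> l2 G"
    and lim: "((\<lambda>i. l2_norm G (\<lambda>x. h x - g i x)) \<longlongrightarrow> 0) F"
  shows "((\<lambda>i. P t (g i) x) \<longlongrightarrow> P t h x) F"
proof -
  have "((\<lambda>i. P t (g i) x - P t h x) \<longlongrightarrow> 0) F"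
  proof (rule Lim_null_comparison)
    show "((\<lambda>i. l2_norm G (\<lambda>x. h x - g i x) / sqrt m0) \<longlongrightarrow> 0) F"
      using tendsto_divide[OF lim tendsto_const, of "sqrt m0"] m0_pos by simp
    show "\<forall>\<^sub>F i in F. norm (P t (g i) x - P t h x) \<le> l2_norm G (\<lambda>x. h x - g i x) / sqrt m0"
      using abs_P_le_l2[where x = x, OF assms(1) l2_diff[OF assms(3,2)]] P_diff[OF assms(1,3,2)]
      by (intro always_eventually allI) (simp add: abs_minus_commute)
  qed
  then show ?thesis by (simp add: LIM_zero_iff)
qed

lemma laplacian_P_form_domain:
  assumes g: "g \<in> form_domain G" and s: "0 < s"
  shows "L (P s g) \<in> l2 G" "(l2_norm G (L (P s g)))\<^sup>2 \<le> dirichlet_form G g g / s"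
proof -
  obtain \<phi> where \<phi>: "\<And>k::nat. \<phi> k \<in> C0"
    "(\<lambda>k. l2_norm G (\<lambda>x. g x - \<phi> k x)) \<longlonglongrightarrow> 0"
    "(\<lambda>k. dirichlet_form G (\<lambda>x. g x - \<phi> k x) (\<lambda>x. g x - \<phi> k x)) \<longlonglongrightarrow> 0"
    using form_domain_approx[OF g] by blast
  let ?Q = "\<lambda>k. dirichlet_form G (\<lambda>x. g x - \<phi> k x) (\<lambda>x. g x - \<phi> k x)"
  let ?C = "sqrt (dirichlet_form G g g / s)"
  have l: "\<phi> k \<in> l2 G" "g \<in> l2 G" for k using \<phi>(1)[of k] C0_subset_l2 form_domain_l2[OF g] by auto
  have C: "?C\<^sup>2 = dirichlet_form G g g / s" using s dirichlet_form_nonneg[of g] by simp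
  have b: "(\<Sum>x\<in>F. m x * (L (P s g) x)\<^sup>2) \<le> ?C\<^sup>2" if F: "finite F" for F
  proof (rule LIMSEQ_le)
    show "(\<lambda>k. \<Sum>x\<in>F. m x * (L (P s (\<phi> k)) x)\<^sup>2) \<longlonglongrightarrow> (\<Sum>x\<in>F. m x * (L (P s g) x)\<^sup>2)"
      using s by (intro tendsto_intros laplacian_tendsto P_tendsto_l2 l \<phi>) auto
    show "(\<lambda>k. (dirichlet_form G g g + ?Q k) / s) \<longlonglongrightarrow> ?C\<^sup>2"
      unfolding C using tendsto_divide[OF tendsto_add[OF tendsto_const \<phi>(3)] tendsto_const, of s] s by simp
    show "\<exists>N. \<forall>k\<ge>N. (\<Sum>x\<in>F. m x * (L (P s (\<phi> k)) x)\<^sup>2) \<le> (dirichlet_form G g g + ?Q k) / s"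
    proof (intro exI allI impI)
      fix k
      have "L (P s (\<phi> k)) \<in> l2 G"
        using s by (simp add: P_laplacian_commute \<phi>(1) P_l2 subsetD[OF C0_subset_l2 laplacian_C0[OF \<phi>(1)]])
      then have "(\<Sum>x\<in>F. m x * (L (P s (\<phi> k)) x)\<^sup>2) \<le> (l2_norm G (L (P s (\<phi> k))))\<^sup>2"
        using F by (rule finite_sum_le_l2_norm)
      also have "\<dots> \<le> dirichlet_form G (\<phi> k) (\<phi> k) / (2 * s)"
        using laplacian_P_bound[OF \<phi>(1) s] s by (simp add: field_simps)
      also have "\<dots> \<le> (2 * dirichlet_form G g g + 2 * ?Q k) / (2 * s)"
      proof (rule divide_right_mono)
        have e: "g \<in> finite_energy G" by (rule form_domain_finite_energy[OF g])
        \<comment> \<open>Uses that the approximant is g - (g - \<phi>).\<close>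
        show "dirichlet_form G (\<phi> k) (\<phi> k) \<le> 2 * dirichlet_form G g g + 2 * ?Q k"
          using dirichlet_form_diff_le(2)[OF e dirichlet_form_diff_le(1)[OF e C0_finite_energy[OF \<phi>(1)[of k]]]]
          by simp
      qed (use s in simp)
      also have "\<dots> = (dirichlet_form G g g + ?Q k) / s" using s by (simp add: field_simps)
      finally show "(\<Sum>x\<in>F. m x * (L (P s (\<phi> k)) x)\<^sup>2) \<le> (dirichlet_form G g g + ?Q k) / s" .
    qed
  qed
  have C0: "0 \<le> ?C" using s dirichlet_form_nonneg[of g] by simp
  from l2_bounded_finite_sums[OF b C0] have "L (P s g) \<in> l2 G" "l2_norm G (L (P s g)) \<le> ?C" by auto
  then show "L (P s g) \<in> l2 G" "(l2_norm G (L (P s g)))\<^sup>2 \<le> dirichlet_form G g g / s"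
    using power_mono[of "l2_norm G (L (P s g))" ?C 2] C by auto
qed

lemma source_l2_form_domain:
  assumes "f \<in> form_domain G" "0 < s"
  shows "source f s \<in> l2 G"
  unfolding source_def
  by (rule l1_imp_l2(1)[OF power2_in_l1(1)[OF laplacian_P_form_domain(1)[OF assms]]])

lemma P_source_nonneg:
  assumes "f \<in> form_domain G" "0 < r" "0 \<le> s"
  shows "0 \<le> P s (source f r) x"
  by (rule P_nonneg[OF source_l2_form_domain[OF assms(1,2)] _ assms(3)]) (simp add: source_def)

text \<open>For fixed r > 0 the smoothing bound, applied to the error f - \<phi>, turns energy
  convergence into l2 convergence of the Laplacians, and their squares converge in l1. The rate
  degenerates as r tends to 0.\<close>

lemma P_source_tendsto:
  assumes f: "f \<in> form_domain G" and \<phi>: "\<And>k::nat. \<phi> k \<in> C0"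
    and lim: "(\<lambda>k. dirichlet_form G (\<lambda>x. f x - \<phi> k x) (\<lambda>x. f x - \<phi> k x)) \<longlonglongrightarrow> 0"
    and r: "0 < r" and s: "0 \<le> s"
  shows "(\<lambda>k. P s (source (\<phi> k) r) x) \<longlonglongrightarrow> P s (source f r) x"
proof (rule P_tendsto_l1[OF s])
  have l2: "L (P r (\<phi> k)) \<in> l2 G" for k
    by (rule laplacian_P_form_domain(1)[OF C0_form_domain[OF \<phi>] r])
  note lf = laplacian_P_form_domain(1)[OF f r]
  have lin: "L (P r f) x - L (P r (\<phi> k)) x = L (P r (\<lambda>x. f x - \<phi> k x)) x" for k x
    using P_diff[of r f "\<phi> k"] r form_domain_l2[OF f] C0_subset_l2 \<phi>[of k] laplacian_diff by auto
  have "(\<lambda>k. l2_norm G (\<lambda>x. L (P r (\<phi> k)) x - L (P r f) x)) \<longlonglongrightarrow> 0"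
  proof (rule tendsto_sandwich[OF _ _ tendsto_const])
    show "(\<lambda>k. sqrt (dirichlet_form G (\<lambda>x. f x - \<phi> k x) (\<lambda>x. f x - \<phi> k x) / r)) \<longlonglongrightarrow> 0"
      using tendsto_real_sqrt[OF tendsto_divide[OF lim tendsto_const, of r]] r by simp
    have "l2_norm G (\<lambda>x. L (P r (\<phi> k)) x - L (P r f) x)
        \<le> sqrt (dirichlet_form G (\<lambda>x. f x - \<phi> k x) (\<lambda>x. f x - \<phi> k x) / r)" for k
      unfolding l2_norm_diff_commute[of "L (P r (\<phi> k))"] lin
      by (intro real_le_rsqrt laplacian_P_form_domain(2) form_domain_diff_C0 f \<phi> r)
    then show "\<forall>\<^sub>F k in sequentially. l2_norm G (\<lambda>x. L (P r (\<phi> k)) x - L (P r f) x)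
        \<le> sqrt (dirichlet_form G (\<lambda>x. f x - \<phi> k x) (\<lambda>x. f x - \<phi> k x) / r)"
      by simp
  qed (auto intro!: always_eventually)
  from l1_norm_power2_tendsto[OF _ lf this] l2
  show "(\<lambda>k. l1_norm (\<lambda>x. source (\<phi> k) r x - source f r x)) \<longlonglongrightarrow> 0"
    by (simp add: source_def)
  show "\<forall>\<^sub>F k in sequentially. source (\<phi> k) r \<in> l2 G \<and> (\<lambda>x. source (\<phi> k) r x - source f r x) \<in> weighted_l1"
    using source_l2_form_domain[OF C0_form_domain[OF \<phi>] r] power2_diff_in_l1[OF l2 lf]
    by (intro always_eventually) (simp add: source_def)
qed (rule source_l2_form_domain[OF f r])

text \<open>Gamma is continuous from the energy seminorm to l1, by \<open>Gamma1_diff_le\<close> and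
  interpolation in delta.\<close>

lemma P_Gamma1_tendsto:
  assumes f: "f \<in> form_domain G" and \<phi>: "\<And>k::nat. \<phi> k \<in> C0"
    and lim: "(\<lambda>k. dirichlet_form G (\<lambda>x. f x - \<phi> k x) (\<lambda>x. f x - \<phi> k x)) \<longlonglongrightarrow> 0"
    and t: "0 \<le> t"
  shows "(\<lambda>k. P t (Gamma1 G (\<phi> k)) x) \<longlonglongrightarrow> P t (Gamma1 G f) x"
proof (rule P_tendsto_l1[OF t])
  note ef = form_domain_finite_energy[OF f] and e\<phi> = C0_finite_energy[OF \<phi>]
  note Gf = Gamma1_l1[OF ef] and Gd = Gamma1_l1[OF dirichlet_form_diff_le(1)[OF e\<phi> ef]]
  show "Gamma1 G f \<in> l2 G" by (rule l1_imp_l2(1)[OF Gf(1)])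
  note le = l1_diff_le[OF Gd(1) Gf(1) _ _ Gamma1_diff_le]
  show "\<forall>\<^sub>F k in sequentially. Gamma1 G (\<phi> k) \<in> l2 G \<and> (\<lambda>x. Gamma1 G (\<phi> k) x - Gamma1 G f x) \<in> weighted_l1"
    using le(1)[of 1] Gamma1_C0_l2[OF \<phi>] by (intro always_eventually) simp
  show "(\<lambda>k. l1_norm (\<lambda>x. Gamma1 G (\<phi> k) x - Gamma1 G f x)) \<longlonglongrightarrow> 0"
  proof (rule tendsto_0_interpolate[OF _ _ _ lim, where c = "dirichlet_form G f f"])
    fix \<delta> :: real assume "0 < \<delta>"
    then show "\<forall>\<^sub>F k in sequentially. l1_norm (\<lambda>x. Gamma1 G (\<phi> k) x - Gamma1 G f x)
        \<le> (1 + 1 / \<delta>) * dirichlet_form G (\<lambda>x. f x - \<phi> k x) (\<lambda>x. f x - \<phi> k x) + \<delta> * dirichlet_form G f f"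
      using le(2)[of \<delta>] by (intro always_eventually) (simp add: Gf(2) Gd(2) dirichlet_form_minus_commute[of f])
  qed (auto intro!: always_eventually l1_norm_nonneg dirichlet_form_nonneg)
qed

lemma gradient_bound_form_domain:
  assumes n: "n > 0" and C0: "\<And>\<phi> x. \<phi> \<in> C0 \<Longrightarrow> deficit K n \<phi> t x \<le> 0"
    and f: "f \<in> form_domain G" and t: "0 < t"
  shows "Gamma1 G (P t f) x \<le> exp (- 2 * K * t) * P t (Gamma1 G f) x
    - 2 / n * (LINT s:{0<..<t}|lborel. exp (- 2 * K * s) * P s (source f (t - s)) x)"
proof -
  obtain \<phi> where \<phi>: "\<And>k::nat. \<phi> k \<in> C0"
    "(\<lambda>k. l2_norm G (\<lambda>x. f x - \<phi> k x)) \<longlonglongrightarrow> 0"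
    "(\<lambda>k. dirichlet_form G (\<lambda>x. f x - \<phi> k x) (\<lambda>x. f x - \<phi> k x)) \<longlonglongrightarrow> 0"
    using form_domain_approx[OF f] by blast
  have l: "\<phi> k \<in> l2 G" "f \<in> l2 G" for k using \<phi>(1)[of k] C0_subset_l2 form_domain_l2[OF f] by auto
  define a where "a g s = indicator {0<..<t} s *\<^sub>R (exp (- 2 * K * s) * P s (source g (t - s)) x)" for g s
  \<comment> \<open>The estimate solved for its integral: for g it says that the integral of
    \<open>a g\<close> is at most \<open>c g\<close>.\<close>
  define c where "c g = n / 2 * (exp (- 2 * K * t) * P t (Gamma1 G g) x - Gamma1 G (P t g) x)" for g
  have a_nonneg: "0 \<le> a g s" if "g \<in> form_domain G" for g s
    using P_source_nonneg[OF that, of "t - s" s x] by (cases "s \<in> {0<..<t}") (auto simp: a_def)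
  have a_lim: "(\<lambda>k. a (\<phi> k) s) \<longlonglongrightarrow> a f s" for s
    by (cases "s \<in> {0<..<t}")
      (auto simp: a_def intro!: tendsto_intros P_source_tendsto[OF f \<phi>(1) \<phi>(3)])
  have a_int: "integrable lborel (a (\<phi> k))" and a_le: "integral\<^sup>L lborel (a (\<phi> k)) \<le> c (\<phi> k)" for k
  proof -
    note d = set_integral_eq_duhamel[OF \<phi>(1)[of k] less_imp_le[OF t], where K = K and x = x]
    show "integrable lborel (a (\<phi> k))"
      using d(1) unfolding set_integrable_def a_def .
    have "integral\<^sup>L lborel (a (\<phi> k)) = duhamel K (\<phi> k) t x"
      using d(2) unfolding set_lebesgue_integral_def a_def .
    then show "integral\<^sup>L lborel (a (\<phi> k)) \<le> c (\<phi> k)"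
      using C0[OF \<phi>(1)[of k], of x] n by (simp add: c_def deficit_def field_simps)
  qed
  have c_lim: "(\<lambda>k. c (\<phi> k)) \<longlonglongrightarrow> c f"
    unfolding c_def using t
    by (intro tendsto_intros P_Gamma1_tendsto[OF f \<phi>(1) \<phi>(3)] Gamma1_tendsto P_tendsto_l2 l \<phi>(2)) auto
  \<comment> \<open>\<open>ennreal\<close> sends negative numbers to 0, so returning from it to the
    reals requires the sign of the limit.\<close>
  have c_nonneg: "0 \<le> c f"
  proof (rule LIMSEQ_le_const[OF c_lim])
    have "0 \<le> c (\<phi> k)" for k
      by (rule order_trans[OF Bochner_Integration.integral_nonneg a_le])
        (rule a_nonneg[OF C0_form_domain[OF \<phi>(1)]])
    then show "\<exists>N. \<forall>k\<ge>N. 0 \<le> c (\<phi> k)" by blast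
  qed
  have meas: "a (\<phi> k) \<in> borel_measurable lborel" for k
    using a_int by (rule borel_measurable_integrable)
  have meas_f: "a f \<in> borel_measurable lborel"
    by (rule borel_measurable_LIMSEQ_real[OF a_lim meas])
  have "(\<integral>\<^sup>+ s. ennreal (a f s) \<partial>lborel) = (\<integral>\<^sup>+ s. liminf (\<lambda>k. ennreal (a (\<phi> k) s)) \<partial>lborel)"
  proof (rule nn_integral_cong)
    fix s
    have "(\<lambda>k. ennreal (a (\<phi> k) s)) \<longlonglongrightarrow> ennreal (a f s)" by (rule tendsto_ennrealI[OF a_lim])
    then show "ennreal (a f s) = liminf (\<lambda>k. ennreal (a (\<phi> k) s))"
      by (simp add: lim_imp_Liminf)
  qed
  also have "\<dots> \<le> liminf (\<lambda>k. \<integral>\<^sup>+ s. ennreal (a (\<phi> k) s) \<partial>lborel)"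
    by (rule nn_integral_liminf) (use meas in measurable)
  also have "\<dots> \<le> liminf (\<lambda>k. ennreal (c (\<phi> k)))"
  proof (rule Liminf_mono, rule always_eventually, rule allI)
    fix k
    have "(\<integral>\<^sup>+ s. ennreal (a (\<phi> k) s) \<partial>lborel) = ennreal (integral\<^sup>L lborel (a (\<phi> k)))"
      by (rule nn_integral_eq_integral[OF a_int]) (simp add: a_nonneg C0_form_domain \<phi>(1))
    also have "\<dots> \<le> ennreal (c (\<phi> k))" by (rule ennreal_leI[OF a_le])
    finally show "(\<integral>\<^sup>+ s. ennreal (a (\<phi> k) s) \<partial>lborel) \<le> ennreal (c (\<phi> k))" .
  qed
  also have "\<dots> = ennreal (c f)"
    by (rule lim_imp_Liminf[OF _ tendsto_ennrealI[OF c_lim]]) simp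
  finally have "(\<integral>\<^sup>+ s. ennreal (a f s) \<partial>lborel) \<le> ennreal (c f)" .
  then have "enn2real (\<integral>\<^sup>+ s. ennreal (a f s) \<partial>lborel) \<le> c f"
    using enn2real_mono[of _ "ennreal (c f)"] c_nonneg by fastforce
  \<comment> \<open>The finite bound just obtained makes \<open>a f\<close> integrable, so this
    equality does not rest on the default value 0 that both sides take for an infinite
    integral.\<close>
  moreover have "integral\<^sup>L lborel (a f) = enn2real (\<integral>\<^sup>+ s. ennreal (a f s) \<partial>lborel)"
    by (rule integral_eq_nn_integral[OF meas_f]) (simp add: a_nonneg f)
  moreover have "(LINT s:{0<..<t}|lborel. exp (- 2 * K * s) * P s (source f (t - s)) x) = integral\<^sup>L lborel (a f)"
    unfolding set_lebesgue_integral_def a_def ..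
  ultimately have "(LINT s:{0<..<t}|lborel. exp (- 2 * K * s) * P s (source f (t - s)) x) \<le> c f"
    by linarith
  then have "2 / n * (LINT s:{0<..<t}|lborel. exp (- 2 * K * s) * P s (source f (t - s)) x) \<le> 2 / n * c f"
    using n by (intro mult_left_mono) auto
  also have "\<dots> = exp (- 2 * K * t) * P t (Gamma1 G f) x - Gamma1 G (P t f) x"
    using n by (simp add: c_def)
  finally show ?thesis by simp
qed

end

theorem theorem3p3:
  fixes G :: "'v graph_data"
    and P :: "real \<Rightarrow> ('v \<Rightarrow> real) \<Rightarrow> 'v \<Rightarrow> real"
    and K n :: real
  assumes "weighted_graph G"
    and "complete_graph G"
    and "nondegenerate G"
    and "heat_semigroup G P"
    and "n > 0"
  shows
    "(CD G K n \<longleftrightarrow>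
       (\<forall>f\<in>C0. \<forall>t>0. \<forall>x.
          Gamma1 G (P t f) x \<le>
            exp (- 2 * K * t) * P t (Gamma1 G f) x
            - 2 / n * (LINT s:{0<..<t}|lborel.
                exp (- 2 * K * s) * P s (\<lambda>y. (laplacian G (P (t - s) f) y)\<^sup>2) x)))
     \<and>
     (CD G K n \<longleftrightarrow>
       (\<forall>f\<in>form_domain G. \<forall>t>0. \<forall>x.
          Gamma1 G (P t f) x \<le>
            exp (- 2 * K * t) * P t (Gamma1 G f) x
            - 2 / n * (LINT s:{0<..<t}|lborel.
                exp (- 2 * K * s) * P s (\<lambda>y. (laplacian G (P (t - s) f) y)\<^sup>2) x)))"
    (is "(?a \<longleftrightarrow> (\<forall>f\<in>C0. ?ineq f)) \<and> (?a \<longleftrightarrow> (\<forall>f\<in>form_domain G. ?ineq f))")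
proof -
  interpret heat_graph G P
    using assms by unfold_locales
  have ineq_iff: "?ineq f \<longleftrightarrow> (\<forall>t>0. \<forall>x. deficit K n f t x \<le> 0)" if "f \<in> C0" for f
    using set_integral_eq_duhamel(2)[OF that, where K = K]
    by (simp add: deficit_def flip: source_def)
  \<comment> \<open>Both equivalences come from the cycle (a) to (c) to (b) to (a), the middle arrow
    being the inclusion of \<open>C0\<close> in the form domain.\<close>
  have "?a \<Longrightarrow> \<forall>f\<in>form_domain G. ?ineq f"
    using gradient_bound_form_domain[OF assms(5) deficit_nonpos[OF _ assms(5)]]
    by (simp add: less_imp_le source_def)
  moreover have "\<forall>f\<in>form_domain G. ?ineq f \<Longrightarrow> \<forall>f\<in>C0. ?ineq f"
    using C0_form_domain by blast
  moreover have "\<forall>f\<in>C0. ?ineq f \<Longrightarrow> ?a"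
    using ineq_iff CD_if_deficit_nonpos[of K n] by blast
  ultimately show ?thesis by blast
qed

end
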